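(* Let $(X_t)_{t\ge 0}$ be a positive recurrent continuous-time Markov chain on a countable state space $E$ with $Q$-matrix $Q=(q_{ij})$, transition semigroup $P_t(i,j)$ and stationary distribution $\pi$ (so $\pi_i>0$ for all $i\in E$). Assume $P_t$ is reversible with respect to $\pi$. Let $f:E\to[1,\infty)$ satisfy $\pi(f^2)<\infty$. Then $P_t$ has exponential $f$-ergodicity if and only if $\mathrm{gap}(Q)>0$. Moreover, the exponential convergence rate of $f$-ergodicity satisfies $\varepsilon_{\max}=\mathrm{gap}(Q)$, and the bound $$\|P_t(i,\cdot)-\pi\|_f\le C(i,f)\,e^{-\mathrm{gap}(Q)\,t},\qquad \forall i\in E,\ t\ge 0,$$ holds with $C(i,f)=\pi(f^2)^{1/2}\left(\pi_i^{-1}-1\right)^{1/2}$.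
   Context: For a signed measure $\mu$ on $E$ and $f:E\to[1,\infty)$, the $f$-norm is $\|\mu\|_f:=\sup_{|g|\le f}|\mu(g)|=\sum_{i\in E} f(i)|\mu_i|$. Reversibility means $\pi_iP_t(i,j)=\pi_jP_t(j,i)$ for all $i,j,t$ (equivalently $\pi_iq_{ij}=\pi_jq_{ji}$). $P_t$ has exponential $f$-ergodicity if there exist $\varepsilon>0$ and constants $C(i,f)\in(0,\infty)$ such that $\|P_t(i,\cdot)-\pi\|_f\le C(i,f)e^{-\varepsilon t}$ for all $i\in E$, $t\ge0$; the supremum of such $\varepsilon$ is denoted $\varepsilon_{\max}$ (the exponential convergence rate of $f$-ergodicity). With $(\cdot,\cdot)$ the inner product of $L^2(\pi)$, the spectral gap is $\mathrm{gap}(Q)=\inf\{(-Qg,g):\ \pi(g)=0,\ \|g\|_{L^2(\pi)}=1\}$, i.e. the optimal constant $C$ in the Poincaré inequality $C\,\mathrm{Var}_\pi(g)\le(-Qg,g)$ for $g\in L^2(\pi)$. *)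

theory Defs
  imports "HOL-Analysis.Analysis"
begin

definition esum :: "('a \<Rightarrow> real) \<Rightarrow> ennreal" where
  "esum h = (\<integral>\<^sup>+ j. ennreal (h j) \<partial>count_space UNIV)"

definition qmatrix :: "('a \<Rightarrow> 'a \<Rightarrow> real) \<Rightarrow> bool" where
  "qmatrix q \<longleftrightarrow> (\<forall>i j. i \<noteq> j \<longrightarrow> 0 \<le> q i j) \<and>
     (\<forall>i. (\<integral>\<^sup>+ j. ennreal (if j = i then 0 else q i j) \<partial>count_space UNIV) = ennreal (- q i i))"

definition q_process :: "('a \<Rightarrow> 'a \<Rightarrow> real) \<Rightarrow> (real \<Rightarrow> 'a \<Rightarrow> 'a \<Rightarrow> real) \<Rightarrow> bool" where
  "q_process q P \<longleftrightarrow>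
     (\<forall>t\<ge>0. \<forall>i j. 0 \<le> P t i j) \<and>
     (\<forall>t\<ge>0. \<forall>i. esum (P t i) \<le> 1) \<and>
     (\<forall>i j. P 0 i j = (if i = j then 1 else 0)) \<and>
     (\<forall>s\<ge>0. \<forall>t\<ge>0. \<forall>i j. ennreal (P (s + t) i j) = esum (\<lambda>k. P s i k * P t k j)) \<and>
     (\<forall>i j. ((\<lambda>t. P t i j) has_real_derivative q i j) (at 0 within {0..}))"

definition markov_chain_of :: "('a \<Rightarrow> 'a \<Rightarrow> real) \<Rightarrow> (real \<Rightarrow> 'a \<Rightarrow> 'a \<Rightarrow> real) \<Rightarrow> bool" where
  "markov_chain_of q P \<longleftrightarrow> qmatrix q \<and> q_process q P \<and>
     (\<forall>t\<ge>0. \<forall>i. esum (P t i) = 1) \<and>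
     (\<forall>P'. q_process q P' \<longrightarrow> (\<forall>t\<ge>0. \<forall>i j. P' t i j = P t i j))"

definition irreducible_tf :: "(real \<Rightarrow> 'a \<Rightarrow> 'a \<Rightarrow> real) \<Rightarrow> bool" where
  "irreducible_tf P \<longleftrightarrow> (\<forall>i j. \<exists>t>0. P t i j > 0)"

definition stationary_dist :: "(real \<Rightarrow> 'a \<Rightarrow> 'a \<Rightarrow> real) \<Rightarrow> ('a \<Rightarrow> real) \<Rightarrow> bool" where
  "stationary_dist P \<pi> \<longleftrightarrow> (\<forall>i. 0 \<le> \<pi> i) \<and> esum \<pi> = 1 \<and>
     (\<forall>t\<ge>0. \<forall>j. esum (\<lambda>i. \<pi> i * P t i j) = ennreal (\<pi> j))"

text \<open>Positive recurrence of an irreducible chain: it has a stationary distribution.\<close>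
definition positive_recurrent :: "(real \<Rightarrow> 'a \<Rightarrow> 'a \<Rightarrow> real) \<Rightarrow> ('a \<Rightarrow> real) \<Rightarrow> bool" where
  "positive_recurrent P \<pi> \<longleftrightarrow> irreducible_tf P \<and> stationary_dist P \<pi>"

definition reversible :: "(real \<Rightarrow> 'a \<Rightarrow> 'a \<Rightarrow> real) \<Rightarrow> ('a \<Rightarrow> real) \<Rightarrow> bool" where
  "reversible P \<pi> \<longleftrightarrow> (\<forall>t\<ge>0. \<forall>i j. \<pi> i * P t i j = \<pi> j * P t j i)"

definition fnorm :: "('a \<Rightarrow> real) \<Rightarrow> ('a \<Rightarrow> real) \<Rightarrow> ennreal" where
  "fnorm f \<mu> = esum (\<lambda>j. f j * \<bar>\<mu> j\<bar>)"

definition exp_rate :: "(real \<Rightarrow> 'a \<Rightarrow> 'a \<Rightarrow> real) \<Rightarrow> ('a \<Rightarrow> real) \<Rightarrow> ('a \<Rightarrow> real) \<Rightarrow> real \<Rightarrow> bool" where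
  "exp_rate P \<pi> f \<epsilon> \<longleftrightarrow> \<epsilon> > 0 \<and> (\<exists>C :: 'a \<Rightarrow> real. (\<forall>i. 0 < C i) \<and>
     (\<forall>i. \<forall>t\<ge>0. fnorm f (\<lambda>j. P t i j - \<pi> j) \<le> ennreal (C i * exp (- \<epsilon> * t))))"

definition exp_f_ergodic :: "(real \<Rightarrow> 'a \<Rightarrow> 'a \<Rightarrow> real) \<Rightarrow> ('a \<Rightarrow> real) \<Rightarrow> ('a \<Rightarrow> real) \<Rightarrow> bool" where
  "exp_f_ergodic P \<pi> f \<longleftrightarrow> (\<exists>\<epsilon>. exp_rate P \<pi> f \<epsilon>)"

text \<open>Maximal exponential rate (supremum of admissible rates; convention sup of empty set = 0).\<close>
definition eps_max :: "(real \<Rightarrow> 'a \<Rightarrow> 'a \<Rightarrow> real) \<Rightarrow> ('a \<Rightarrow> real) \<Rightarrow> ('a \<Rightarrow> real) \<Rightarrow> ereal" where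
  "eps_max P \<pi> f = Sup ({0} \<union> ereal ` {\<epsilon>. exp_rate P \<pi> f \<epsilon>})"

text \<open>Dirichlet form (-Qg,g) = 1/2 sum_{i<>j} pi_i q_ij (g_j - g_i)^2 of a reversible Q.\<close>
definition dirichlet :: "('a \<Rightarrow> 'a \<Rightarrow> real) \<Rightarrow> ('a \<Rightarrow> real) \<Rightarrow> ('a \<Rightarrow> real) \<Rightarrow> ennreal" where
  "dirichlet q \<pi> g = (\<integral>\<^sup>+ ij. ennreal (if fst ij = snd ij then 0 else
       \<pi> (fst ij) * q (fst ij) (snd ij) * (g (snd ij) - g (fst ij))\<^sup>2 / 2) \<partial>count_space UNIV)"

definition L2_normalized_centered :: "('a \<Rightarrow> real) \<Rightarrow> ('a \<Rightarrow> real) \<Rightarrow> bool" where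
  "L2_normalized_centered \<pi> g \<longleftrightarrow> esum (\<lambda>i. \<pi> i * (g i)\<^sup>2) = 1 \<and> infsum (\<lambda>i. \<pi> i * g i) UNIV = 0"

definition spectral_gap :: "('a \<Rightarrow> 'a \<Rightarrow> real) \<Rightarrow> ('a \<Rightarrow> real) \<Rightarrow> real" where
  "spectral_gap q \<pi> = enn2real (INF g \<in> {g. L2_normalized_centered \<pi> g}. dirichlet q \<pi> g)"

end

theory Submission
  imports Defs "HOL-Probability.Probability_Mass_Function"
begin

text \<open>
  For bounded \<open>u\<close> the energy of \<open>P\<^sub>t\<close> is \<open>(u - P\<^sub>t u, u)\<close>, half the \<open>\<pi>(i) P\<^sub>t(i,j)\<close>-weighted sum of
  \<open>(u(j) - u(i))\<^sup>2\<close>.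

  Decay: by Fatou, the Dirichlet form of \<open>Q\<close> is at most the lower limit of energy over \<open>t\<close>, so the Poincare
  inequality bounds the lower derivative of \<open>t \<mapsto> (P\<^sub>t u, u)\<close> and gives exponential decay at rate \<open>gap(Q)\<close>.
  Applied to \<open>u = 1\<^sub>i / \<pi>(i) - 1\<close>, for which \<open>P\<^sub>t u(j) = P\<^sub>t(i,j) / \<pi>(j) - 1\<close>, Cauchy-Schwarz yields the stated
  bound.

  Converse: a rate \<open>\<epsilon>\<close> gives \<open>(P\<^sub>t u, u) = O(e\<^bsup>-\<epsilon>t\<^esup>)\<close> for centered finitely supported \<open>u\<close>; since
  \<open>(P\<^sub>t u, u)\<^sup>2 \<le> (u, u) (P\<^bsub>2t\<^esub> u, u)\<close>, the implied constant can be taken to be \<open>(u, u)\<close>, and by density the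
  variance decays at rate \<open>\<epsilon>\<close> for every bounded \<open>u\<close>. It remains to see that the energy of \<open>P\<^sub>t\<close> is at most \<open>t\<close>
  times the Dirichlet form on its maximal domain, and this is where uniqueness of the process enters.
  Killing \<open>P\<close> outside finite sets and taking the supremum produces a process with the same \<open>Q\<close>-matrix, hence
  \<open>P\<close> itself. On a finite set the killed kernels are dominated by reversible kernels in which the jumps
  leaving the set are suppressed. The energies of the latter are controlled by the Dirichlet form, and since
  \<open>P\<close> is honest the mass lost by killing vanishes as the finite sets grow. Truncation then removes boundedness.
\<close>

section \<open>The minimal process\<close>

text \<open>For a finite set \<open>A\<close>, this is the kernel of the chain observed only at the
  grid times given by the successive increments, killed at the first of these times, the start
  included, that finds it outside \<open>A\<close>.\<close>

fun taboo :: "(real \<Rightarrow> 'a \<Rightarrow> 'a \<Rightarrow> real) \<Rightarrow> 'a set \<Rightarrow> real list \<Rightarrow> 'a \<Rightarrow> 'a \<Rightarrow> real" where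
  "taboo P A [] i j = (if i = j \<and> i \<in> A then 1 else 0)"
| "taboo P A (s # ss) i j = (if i \<in> A then \<Sum>k\<in>A. P s i k * taboo P A ss k j else 0)"

definition partitions :: "real \<Rightarrow> real list set" where
  "partitions t = {xs. (\<forall>x\<in>set xs. 0 \<le> x) \<and> sum_list xs = t}"

text \<open>For finite \<open>A\<close>, the kernel of the chain killed on leaving \<open>A\<close>,
  built without sample paths: refining a partition lowers the taboo kernel, so the infimum is a
  limit along refinements.\<close>

definition killed :: "(real \<Rightarrow> 'a \<Rightarrow> 'a \<Rightarrow> real) \<Rightarrow> 'a set \<Rightarrow> real \<Rightarrow> 'a \<Rightarrow> 'a \<Rightarrow> real" where
  "killed P A t i j = (INF xs\<in>partitions t. taboo P A xs i j)"

definition initial :: "nat \<Rightarrow> 'a::countable set" where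
  "initial n = {x. to_nat x < n}"

text \<open>The finite sets \<open>initial n\<close> exhaust the countable state space. Since the
  killed kernels are made from \<open>P\<close>, the result lies below \<open>P\<close>; it will
  turn out to have the same Q-matrix.\<close>

definition minimal :: "(real \<Rightarrow> 'a::countable \<Rightarrow> 'a \<Rightarrow> real) \<Rightarrow> real \<Rightarrow> 'a \<Rightarrow> 'a \<Rightarrow> real" where
  "minimal P t i j = (SUP n. killed P (initial n) t i j)"

lemma finite_initial [simp]: "finite (initial n)"
proof -
  have "initial n = to_nat -` {..<n}" by (auto simp: initial_def)
  then show ?thesis by (metis finite_lessThan finite_vimageI inj_to_nat)
qed

lemma initial_mono: "m \<le> n \<Longrightarrow> initial m \<subseteq> initial n"
  by (auto simp: initial_def)

lemma eventually_initial: "eventually (\<lambda>n. x \<in> initial n) sequentially"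
  unfolding initial_def by (simp add: eventually_gt_at_top)

lemma sum_le_esum:
  assumes "finite A" "\<And>k. 0 \<le> h k"
  shows "ennreal (\<Sum>k\<in>A. h k) \<le> esum h"
proof -
  have "ennreal (\<Sum>k\<in>A. h k) = (\<integral>\<^sup>+ k. ennreal (h k) \<partial>count_space A)"
    using assms by (simp add: nn_integral_count_space_finite)
  also have "\<dots> = (\<integral>\<^sup>+ k. ennreal (h k) * indicator A k \<partial>count_space UNIV)"
    by (subst nn_integral_count_space_indicator) auto
  also have "\<dots> \<le> esum h" unfolding esum_def
    by (intro nn_integral_mono) (auto simp: indicator_def)
  finally show ?thesis .
qed

lemma esum_finite_support:
  assumes "finite A" "\<And>k. 0 \<le> h k" "\<And>k. k \<notin> A \<Longrightarrow> h k = 0"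
  shows "esum h = ennreal (\<Sum>k\<in>A. h k)"
proof -
  have "ennreal (\<Sum>k\<in>A. h k) = (\<integral>\<^sup>+ k. ennreal (h k) \<partial>count_space A)"
    using assms by (simp add: nn_integral_count_space_finite)
  also have "\<dots> = (\<integral>\<^sup>+ k. ennreal (h k) * indicator A k \<partial>count_space UNIV)"
    by (subst nn_integral_count_space_indicator) auto
  also have "\<dots> = esum h" unfolding esum_def
    using assms(3) by (intro nn_integral_cong) (auto simp: indicator_def)
  finally show ?thesis by simp
qed

locale q_transition =
  fixes q :: "'a::countable \<Rightarrow> 'a \<Rightarrow> real" and P :: "real \<Rightarrow> 'a \<Rightarrow> 'a \<Rightarrow> real"
  assumes q_process: "q_process q P"
begin

lemma P_nonneg: "0 \<le> t \<Longrightarrow> 0 \<le> P t i j"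
  using q_process by (auto simp: q_process_def)

lemma P_substochastic: "0 \<le> t \<Longrightarrow> esum (P t i) \<le> 1"
  using q_process by (auto simp: q_process_def)

lemma P_zero: "P 0 i j = (if i = j then 1 else 0)"
  using q_process by (auto simp: q_process_def)

lemma chapman_kolmogorov:
  "0 \<le> s \<Longrightarrow> 0 \<le> t \<Longrightarrow> ennreal (P (s + t) i j) = esum (\<lambda>k. P s i k * P t k j)"
  using q_process by (auto simp: q_process_def)

lemma P_deriv: "((\<lambda>t. P t i j) has_real_derivative q i j) (at 0 within {0..})"
  using q_process by (auto simp: q_process_def)

lemma P_le_1:
  assumes "0 \<le> t" shows "P t i j \<le> 1"
proof -
  have "ennreal (\<Sum>k\<in>{j}. P t i k) \<le> esum (P t i)"
    using assms by (intro sum_le_esum) (auto simp: P_nonneg)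
  also have "\<dots> \<le> 1" using assms by (rule P_substochastic)
  finally show ?thesis by simp
qed

lemma chapman_kolmogorov_ge:
  assumes "finite A" "0 \<le> s" "0 \<le> t"
  shows "(\<Sum>k\<in>A. P s i k * P t k j) \<le> P (s + t) i j"
proof -
  have "ennreal (\<Sum>k\<in>A. P s i k * P t k j) \<le> esum (\<lambda>k. P s i k * P t k j)"
    using assms by (intro sum_le_esum) (auto simp: P_nonneg)
  then show ?thesis
    using assms by (simp add: chapman_kolmogorov[symmetric] P_nonneg)
qed

section \<open>Taboo kernels under refinement of partitions\<close>

lemma taboo_nonneg: "\<forall>x\<in>set xs. 0 \<le> x \<Longrightarrow> 0 \<le> taboo P A xs i j"
  by (induction xs arbitrary: i) (auto intro!: sum_nonneg mult_nonneg_nonneg simp: P_nonneg)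

lemma taboo_outside1: "i \<notin> A \<Longrightarrow> taboo P A xs i j = 0"
  by (cases xs) auto

lemma taboo_outside2: "j \<notin> A \<Longrightarrow> taboo P A xs i j = 0"
  by (induction xs arbitrary: i) auto

lemma taboo_append:
  assumes "finite A"
  shows "taboo P A (xs @ ys) i j = (\<Sum>k\<in>A. taboo P A xs i k * taboo P A ys k j)"
proof (induction xs arbitrary: i)
  case Nil
  have "(\<Sum>k\<in>A. (if i = k \<and> i \<in> A then 1 else 0) * taboo P A ys k j)
      = (\<Sum>k\<in>A. if k = i then taboo P A ys k j else 0)"
    by (intro sum.cong) auto
  then show ?case using assms by (simp add: taboo_outside1)
next
  case (Cons x xs)
  show ?case
  proof (cases "i \<in> A")
    case True
    have "taboo P A ((x # xs) @ ys) i j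
        = (\<Sum>l\<in>A. \<Sum>k\<in>A. P x i l * (taboo P A xs l k * taboo P A ys k j))"
      using True by (simp add: Cons sum_distrib_left)
    also have "\<dots> = (\<Sum>k\<in>A. \<Sum>l\<in>A. P x i l * (taboo P A xs l k * taboo P A ys k j))"
      by (rule sum.swap)
    finally show ?thesis using True by (simp add: sum_distrib_right mult.assoc)
  qed auto
qed

lemma taboo_Cons_mono:
  assumes "0 \<le> x" "\<And>k. taboo P A xs k j \<le> taboo P A ys k j"
  shows "taboo P A (x # xs) i j \<le> taboo P A (x # ys) i j"
  using assms by (auto intro!: sum_mono mult_left_mono simp: P_nonneg)

lemma taboo_le:
  assumes "finite A" "\<forall>x\<in>set xs. 0 \<le> x"
  shows "taboo P A xs i j \<le> P (sum_list xs) i j"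
  using assms(2)
proof (induction xs arbitrary: i)
  case (Cons x xs)
  then have nn: "0 \<le> x" "0 \<le> sum_list xs" by (auto intro: sum_list_nonneg)
  have "taboo P A (x # xs) i j \<le> (\<Sum>k\<in>A. P x i k * P (sum_list xs) k j)"
    using Cons nn by (auto intro!: sum_mono mult_left_mono sum_nonneg mult_nonneg_nonneg simp: P_nonneg)
  also have "\<dots> \<le> P (x + sum_list xs) i j"
    using nn assms(1) by (intro chapman_kolmogorov_ge)
  finally show ?case by simp
qed (auto simp: P_zero)

lemma taboo_mono:
  assumes "finite B" "A \<subseteq> B" "\<forall>x\<in>set xs. 0 \<le> x"
  shows "taboo P A xs i j \<le> taboo P B xs i j"
  using assms(3)
proof (induction xs arbitrary: i)
  case (Cons x xs)
  show ?case
  proof (cases "i \<in> A")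
    case True
    have "taboo P A (x # xs) i j \<le> (\<Sum>k\<in>A. P x i k * taboo P B xs k j)"
      using Cons True by (auto intro!: sum_mono mult_left_mono simp: P_nonneg)
    also have "\<dots> \<le> (\<Sum>k\<in>B. P x i k * taboo P B xs k j)"
      using Cons assms by (intro sum_mono2) (auto simp: P_nonneg taboo_nonneg)
    finally show ?thesis using True assms by auto
  qed (use Cons.prems taboo_nonneg[of "x # xs"] in auto)
qed (use assms in auto)

text \<open>A grid time inserted between \<open>a\<close> and \<open>b\<close> restricts the
  Chapman-Kolmogorov sum for \<open>P (a + b)\<close> to intermediate states in
  \<open>A\<close>.\<close>

lemma taboo_refine:
  assumes "finite A" "0 \<le> a" "0 \<le> b" "\<forall>x\<in>set xs. 0 \<le> x"
  shows "taboo P A (a # b # xs) i j \<le> taboo P A ((a + b) # xs) i j"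
proof (cases "i \<in> A")
  case True
  have "taboo P A (a # b # xs) i j = (\<Sum>k\<in>A. \<Sum>l\<in>A. P a i k * (P b k l * taboo P A xs l j))"
    using True by (simp add: sum_distrib_left)
  also have "\<dots> = (\<Sum>l\<in>A. (\<Sum>k\<in>A. P a i k * P b k l) * taboo P A xs l j)"
    by (subst sum.swap) (simp add: sum_distrib_right mult.assoc)
  also have "\<dots> \<le> (\<Sum>l\<in>A. P (a + b) i l * taboo P A xs l j)"
    using assms by (intro sum_mono mult_right_mono chapman_kolmogorov_ge) (auto simp: taboo_nonneg)
  finally show ?thesis using True by simp
qed auto

lemma taboo_null_steps:
  assumes "finite A" "\<forall>x\<in>set xs. x = 0"
  shows "taboo P A xs i j = taboo P A [] i j"
  using assms(2)
proof (induction xs arbitrary: i)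
  case (Cons x xs)
  then have "taboo P A (x # xs) i j
      = (if i \<in> A then \<Sum>k\<in>A. if k = i then taboo P A [] k j else 0 else 0)"
    by (auto simp: P_zero intro!: sum.cong)
  then show ?case using assms(1) by auto
qed auto

text \<open>Two grids can be merged, so the taboo kernels are directed downwards; this lets one
  sequence of partitions approximate all entries at once. The induction on the total length cuts off
  the shorter of the two first steps.\<close>

lemma taboo_common_refinement:
  assumes A: "finite A" and "xs \<in> partitions t" "ys \<in> partitions t"
  shows "\<exists>zs\<in>partitions t. \<forall>i j. taboo P A zs i j \<le> taboo P A xs i j \<and> taboo P A zs i j \<le> taboo P A ys i j"
  using assms(2,3)
proof (induction "length xs + length ys" arbitrary: xs ys t rule: less_induct)
  case less
  \<comment> \<open>An empty list forces \<open>t = 0\<close>, and then every increment of the other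
    list is 0.\<close>
  have null: "\<exists>zs\<in>partitions t. \<forall>i j. taboo P A zs i j \<le> taboo P A [] i j \<and> taboo P A zs i j \<le> taboo P A vs i j"
    if "[] \<in> partitions t" "vs \<in> partitions t" for vs
  proof -
    have "\<forall>x\<in>set vs. x = 0"
      using that sum_list_nonneg_eq_0_iff[of vs] by (auto simp: partitions_def)
    then show ?thesis using that taboo_null_steps[OF A] by (intro bexI[of _ "[]"]) auto
  qed
  \<comment> \<open>Cutting \<open>y\<close> at \<open>x\<close> leaves partitions of
    \<open>t - x\<close> of smaller total length: \<open>x\<close> disappears from one list, and
    \<open>y\<close> is replaced by \<open>y - x\<close> in the other.\<close>
  have step: "\<exists>zs\<in>partitions t. \<forall>i j. taboo P A zs i j \<le> taboo P A (x # us) i j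
      \<and> taboo P A zs i j \<le> taboo P A (y # vs) i j"
    if le: "x \<le> y" and len: "length us + length vs + 2 \<le> length xs + length ys"
      and pu: "x # us \<in> partitions t" and pv: "y # vs \<in> partitions t" for x y us vs
  proof -
    from pu pv have nn: "0 \<le> x" "0 \<le> y - x" "\<forall>v\<in>set vs. 0 \<le> v"
      using le by (auto simp: partitions_def)
    have "us \<in> partitions (t - x)" "(y - x) # vs \<in> partitions (t - x)"
      using pu pv le by (auto simp: partitions_def)
    from less.hyps[OF _ this] len obtain zs where zs: "zs \<in> partitions (t - x)"
      "\<And>i j. taboo P A zs i j \<le> taboo P A us i j"
      "\<And>i j. taboo P A zs i j \<le> taboo P A ((y - x) # vs) i j"
      by auto
    have "x # zs \<in> partitions t" using zs(1) nn by (auto simp: partitions_def)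
    moreover have "taboo P A (x # zs) i j \<le> taboo P A (x # us) i j" for i j
      using nn zs by (intro taboo_Cons_mono)
    moreover have "taboo P A (x # zs) i j \<le> taboo P A (y # vs) i j" for i j
    proof -
      have "taboo P A (x # zs) i j \<le> taboo P A (x # (y - x) # vs) i j"
        using nn zs by (intro taboo_Cons_mono)
      also have "\<dots> \<le> taboo P A ((x + (y - x)) # vs) i j"
        using nn by (intro taboo_refine A)
      finally show ?thesis by simp
    qed
    ultimately show ?thesis by blast
  qed
  show ?case
  proof (cases xs)
    case Nil
    then show ?thesis using null[of ys] less.prems by auto
  next
    case (Cons x us)
    note xs = this
    show ?thesis
    proof (cases ys)
      case Nil
      then show ?thesis using null[of xs] less.prems by blast
    next
      case (Cons y vs)
      show ?thesis
      proof (cases "x \<le> y")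
        case True
        then show ?thesis using step[of x y us vs] less.prems unfolding xs Cons by auto
      next
        case False
        then have "y \<le> x" by simp
        moreover have "length vs + length us + 2 \<le> length xs + length ys" using xs Cons by simp
        ultimately have "\<exists>zs\<in>partitions t. \<forall>i j. taboo P A zs i j \<le> taboo P A ys i j
            \<and> taboo P A zs i j \<le> taboo P A xs i j"
          using less.prems(2,1) unfolding xs Cons by (rule step[unfolded xs Cons])
        then show ?thesis by blast
      qed
    qed
  qed
qed

text \<open>A grid time is inserted at \<open>s\<close> by cutting the step that straddles it. This
  serves the half of the semigroup law in which the product is bounded by
  \<open>killed P A (s + t)\<close>.\<close>

lemma taboo_split:
  assumes A: "finite A" and "0 \<le> s" "0 \<le> t" "zs \<in> partitions (s + t)"
  shows "\<exists>xs\<in>partitions s. \<exists>ys\<in>partitions t. \<forall>i j. taboo P A (xs @ ys) i j \<le> taboo P A zs i j"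
  using assms(2-)
proof (induction zs arbitrary: s)
  case Nil
  then have "s = 0" "t = 0" by (auto simp: partitions_def)
  then show ?case by (intro bexI[of _ "[]"]) (auto simp: partitions_def)
next
  case (Cons z zs)
  then have nn: "0 \<le> z" "\<forall>v\<in>set zs. 0 \<le> v" and sum: "z + sum_list zs = s + t"
    by (auto simp: partitions_def)
  show ?case
  proof (cases "z \<le> s")
    case True
    then have "zs \<in> partitions ((s - z) + t)" using Cons by (auto simp: partitions_def)
    with Cons.IH[of "s - z"] True Cons.prems obtain xs ys where
      *: "xs \<in> partitions (s - z)" "ys \<in> partitions t"
        "\<And>i j. taboo P A (xs @ ys) i j \<le> taboo P A zs i j" by auto
    have "taboo P A ((z # xs) @ ys) i j \<le> taboo P A (z # zs) i j" for i j
      using taboo_Cons_mono[OF nn(1), of A "xs @ ys" j zs i] * by simp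
    moreover have "z # xs \<in> partitions s" using * nn by (auto simp: partitions_def)
    ultimately show ?thesis using * by blast
  next
    case False
    have "taboo P A ([s] @ ((z - s) # zs)) i j \<le> taboo P A (z # zs) i j" for i j
      using taboo_refine[OF A, of s "z - s" zs i j] False Cons.prems nn by simp
    moreover have "[s] \<in> partitions s" using Cons.prems by (auto simp: partitions_def)
    moreover have "(z - s) # zs \<in> partitions t" using Cons.prems nn sum False
      by (auto simp: partitions_def)
    ultimately show ?thesis by blast
  qed
qed

section \<open>The killed semigroup on a finite set\<close>

lemma singleton_partition: "0 \<le> t \<Longrightarrow> [t] \<in> partitions t"
  by (auto simp: partitions_def)

lemma bdd_below_taboo: "bdd_below ((\<lambda>xs. taboo P A xs i j) ` partitions t)"
  by (rule bdd_belowI[of _ 0]) (auto simp: partitions_def intro!: taboo_nonneg)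

lemma killed_lower: "xs \<in> partitions t \<Longrightarrow> killed P A t i j \<le> taboo P A xs i j"
  unfolding killed_def by (intro cINF_lower bdd_below_taboo)

lemma killed_greatest:
  "0 \<le> t \<Longrightarrow> (\<And>xs. xs \<in> partitions t \<Longrightarrow> c \<le> taboo P A xs i j) \<Longrightarrow> c \<le> killed P A t i j"
  unfolding killed_def using singleton_partition by (intro cINF_greatest) auto

lemma killed_nonneg: "0 \<le> t \<Longrightarrow> 0 \<le> killed P A t i j"
  by (rule killed_greatest) (auto simp: partitions_def intro!: taboo_nonneg)

lemma killed_le:
  assumes "finite A" "0 \<le> t"
  shows "killed P A t i j \<le> P t i j"
proof -
  have "killed P A t i j \<le> taboo P A [t] i j"
    using assms by (intro killed_lower singleton_partition)
  also have "\<dots> \<le> P t i j" using taboo_le[of A "[t]"] assms by simp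
  finally show ?thesis .
qed

lemma killed_mono:
  assumes "finite B" "A \<subseteq> B" "0 \<le> t"
  shows "killed P A t i j \<le> killed P B t i j"
proof (rule killed_greatest)
  fix xs assume "xs \<in> partitions t"
  then show "killed P A t i j \<le> taboo P B xs i j"
    using killed_lower[of xs t A i j] taboo_mono[OF assms(1,2), of xs i j] by (auto simp: partitions_def)
qed (use assms in auto)

lemma killed_outside2:
  assumes "0 \<le> t" "j \<notin> A"
  shows "killed P A t i j = 0"
  using killed_lower[OF singleton_partition[OF assms(1)], of A i j] killed_nonneg[OF assms(1), of A i j]
    taboo_outside2[OF assms(2), of "[t]" i] by (metis antisym)

text \<open>One sequence serves all entries because only the finitely many in
  \<open>A \<times> A\<close> can be nonzero, and finitely many near-optimal partitions have a
  common refinement. Limits can then be taken inside finite sums.\<close>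

lemma killed_approx:
  assumes A: "finite A" and t: "0 \<le> t"
  shows "\<exists>X. (\<forall>n. X n \<in> partitions t) \<and>
    (\<forall>i j. (\<lambda>n. taboo P A (X n) i j) \<longlonglongrightarrow> killed P A t i j)"
proof -
  have single: "\<exists>xs\<in>partitions t. taboo P A xs i j \<le> killed P A t i j + e" if "0 < e" for i j e
  proof (rule ccontr)
    assume "\<not> ?thesis"
    then have "killed P A t i j + e \<le> killed P A t i j"
      using t by (intro killed_greatest) force+
    with that show False by simp
  qed
  have fin: "\<exists>xs\<in>partitions t. \<forall>p\<in>F. taboo P A xs (fst p) (snd p) \<le> killed P A t (fst p) (snd p) + e"
    if e: "0 < e" and F: "finite F" for F e
    using F
  proof (induction F)
    case empty
    then show ?case using singleton_partition[OF t] by auto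
  next
    case (insert p F)
    then obtain xs where xs: "xs \<in> partitions t"
      "\<forall>p\<in>F. taboo P A xs (fst p) (snd p) \<le> killed P A t (fst p) (snd p) + e" by auto
    obtain ys where ys: "ys \<in> partitions t"
      "taboo P A ys (fst p) (snd p) \<le> killed P A t (fst p) (snd p) + e"
      using single[OF e] by blast
    obtain zs where "zs \<in> partitions t"
      "\<And>i j. taboo P A zs i j \<le> taboo P A xs i j \<and> taboo P A zs i j \<le> taboo P A ys i j"
      using taboo_common_refinement[OF A xs(1) ys(1)] by blast
    then show ?case using xs ys by (intro bexI[of _ zs]) (auto intro: order_trans)
  qed
  have "\<exists>xs\<in>partitions t. \<forall>i j. taboo P A xs i j \<le> killed P A t i j + 1 / real (Suc n)" for n
  proof -
    obtain xs where xs: "xs \<in> partitions t" "\<And>i j. i \<in> A \<Longrightarrow> j \<in> A \<Longrightarrow>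
        taboo P A xs i j \<le> killed P A t i j + 1 / real (Suc n)"
      using fin[of "1 / real (Suc n)" "A \<times> A"] A by auto
    have "taboo P A xs i j \<le> killed P A t i j + 1 / real (Suc n)" for i j
      using xs(2)[of i j] taboo_outside1[of i A xs j] taboo_outside2[of j A xs i] killed_nonneg[OF t, of A i j]
      by (cases "i \<in> A \<and> j \<in> A") auto
    with xs(1) show ?thesis by blast
  qed
  then obtain X where X: "\<And>n. X n \<in> partitions t"
    "\<And>n i j. taboo P A (X n) i j \<le> killed P A t i j + 1 / real (Suc n)"
    by metis
  have "(\<lambda>n. taboo P A (X n) i j) \<longlonglongrightarrow> killed P A t i j" for i j
  proof (rule tendsto_sandwich[where f = "\<lambda>n. killed P A t i j"])
    show "(\<lambda>n. killed P A t i j + 1 / real (Suc n)) \<longlonglongrightarrow> killed P A t i j"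
      using tendsto_add[OF tendsto_const LIMSEQ_inverse_real_of_nat, of "killed P A t i j"]
      by (simp add: inverse_eq_divide)
    show "(\<lambda>n. killed P A t i j) \<longlonglongrightarrow> killed P A t i j" by simp
  qed (use X killed_lower in \<open>auto intro!: always_eventually simp del: of_nat_Suc\<close>)
  with X show ?thesis by blast
qed

text \<open>Concatenating partitions of \<open>s\<close> and \<open>t\<close> bounds the left side
  by the product; splitting a partition of \<open>s + t\<close> at \<open>s\<close> gives the
  converse.\<close>

lemma killed_semigroup:
  assumes A: "finite A" and s: "0 \<le> s" and t: "0 \<le> t"
  shows "killed P A (s + t) i j = (\<Sum>k\<in>A. killed P A s i k * killed P A t k j)"
proof (rule antisym)
  obtain X where X: "\<And>n. X n \<in> partitions s" "\<And>i j. (\<lambda>n. taboo P A (X n) i j) \<longlonglongrightarrow> killed P A s i j"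
    using killed_approx[OF A s] by blast
  obtain Y where Y: "\<And>n. Y n \<in> partitions t" "\<And>i j. (\<lambda>n. taboo P A (Y n) i j) \<longlonglongrightarrow> killed P A t i j"
    using killed_approx[OF A t] by blast
  have lim: "(\<lambda>n. \<Sum>k\<in>A. taboo P A (X n) i k * taboo P A (Y n) k j)
      \<longlonglongrightarrow> (\<Sum>k\<in>A. killed P A s i k * killed P A t k j)"
    by (intro tendsto_sum tendsto_mult X Y)
  have "killed P A (s + t) i j \<le> (\<Sum>k\<in>A. taboo P A (X n) i k * taboo P A (Y n) k j)" for n
  proof -
    have "X n @ Y n \<in> partitions (s + t)" using X(1)[of n] Y(1)[of n] by (auto simp: partitions_def)
    then show ?thesis using taboo_append[OF A, of "X n" "Y n" i j] killed_lower[of "X n @ Y n"] by metis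
  qed
  then show "killed P A (s + t) i j \<le> (\<Sum>k\<in>A. killed P A s i k * killed P A t k j)"
    by (intro LIMSEQ_le_const[OF lim]) auto
next
  show "(\<Sum>k\<in>A. killed P A s i k * killed P A t k j) \<le> killed P A (s + t) i j"
  proof (rule killed_greatest)
    fix zs assume "zs \<in> partitions (s + t)"
    then obtain xs ys where xy: "xs \<in> partitions s" "ys \<in> partitions t"
      "\<And>i j. taboo P A (xs @ ys) i j \<le> taboo P A zs i j"
      using taboo_split[OF A s t] by blast
    have "(\<Sum>k\<in>A. killed P A s i k * killed P A t k j) \<le> taboo P A (xs @ ys) i j"
      unfolding taboo_append[OF A] using xy
      by (intro sum_mono mult_mono killed_lower killed_nonneg taboo_nonneg s t) (auto simp: partitions_def)
    also have "\<dots> \<le> taboo P A zs i j" by (rule xy(3))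
    finally show "(\<Sum>k\<in>A. killed P A s i k * killed P A t k j) \<le> taboo P A zs i j" .
  qed (use s t in auto)
qed

section \<open>Lower bounds for short times\<close>

lemma diag_power_le:
  assumes "0 \<le> s"
  shows "P s i i ^ n \<le> P (real n * s) i i"
proof (induction n)
  case (Suc n)
  have "P s i i ^ Suc n \<le> P s i i * P (real n * s) i i"
    using Suc assms by (simp add: mult_left_mono P_nonneg)
  also have "\<dots> \<le> P (s + real n * s) i i"
    using chapman_kolmogorov_ge[of "{i}" s "real n * s" i i] assms by simp
  finally show ?case by (simp add: algebra_simps)
qed (simp add: P_zero)

text \<open>\<open>P t i i\<close> is at least the n-th power of \<open>P (t / n) i i\<close>, and n
  times the logarithm of the latter tends to \<open>q i i * t\<close> by the derivative at
  0.\<close>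

lemma diag_ge:
  assumes "0 \<le> t"
  shows "exp (q i i * t) \<le> P t i i"
proof (cases "t = 0")
  case False
  with assms have t: "0 < t" by simp
  have ev: "eventually (\<lambda>n. 0 < P (t / real (Suc n)) i i) sequentially"
    and lim: "(\<lambda>n. real (Suc n) * ln (P (t / real (Suc n)) i i)) \<longlonglongrightarrow> q i i * t"
  proof -
    have "((\<lambda>s. ln (P s i i)) has_real_derivative q i i) (at 0 within {0..})"
      using DERIV_chain2[OF DERIV_ln_divide P_deriv, of i i] by (simp add: P_zero)
    then have D: "((\<lambda>s. (ln (P s i i) - ln (P 0 i i)) / (s - 0)) \<longlongrightarrow> q i i) (at 0 within {0..})"
      by (simp add: has_field_derivative_iff)
    have f: "filterlim (\<lambda>n. t / real (Suc n)) (at 0 within {0..}) sequentially"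
      unfolding filterlim_at
    proof
      show "(\<lambda>n. t / real (Suc n)) \<longlonglongrightarrow> 0"
        using tendsto_mult[OF tendsto_const LIMSEQ_inverse_real_of_nat, of t] by (simp add: divide_inverse)
    qed (use t in auto)
    have "(\<lambda>n. t * ((ln (P (t / real (Suc n)) i i) - ln (P 0 i i)) / (t / real (Suc n) - 0))) \<longlonglongrightarrow> t * q i i"
      by (intro tendsto_mult tendsto_const filterlim_compose[OF D f])
    moreover have "t * ((ln (P (t / real (Suc n)) i i) - ln (P 0 i i)) / (t / real (Suc n) - 0))
        = real (Suc n) * ln (P (t / real (Suc n)) i i)" for n
      using t by (simp add: P_zero)
    ultimately show "(\<lambda>n. real (Suc n) * ln (P (t / real (Suc n)) i i)) \<longlonglongrightarrow> q i i * t"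
      by (simp only: mult.commute)
    have "((\<lambda>s. P s i i) \<longlongrightarrow> P 0 i i) (at 0 within {0..})"
      using DERIV_continuous[OF P_deriv] by (auto simp: continuous_within)
    from filterlim_compose[OF this f] have "(\<lambda>n. P (t / real (Suc n)) i i) \<longlonglongrightarrow> 1"
      by (simp add: P_zero)
    then show "eventually (\<lambda>n. 0 < P (t / real (Suc n)) i i) sequentially"
      by (rule order_tendstoD) simp
  qed
  have "eventually (\<lambda>n. exp (real (Suc n) * ln (P (t / real (Suc n)) i i)) \<le> P t i i) sequentially"
    using ev
  proof eventually_elim
    case (elim n)
    have "exp (real (Suc n) * ln (P (t / real (Suc n)) i i)) = P (t / real (Suc n)) i i ^ Suc n"
      using elim by (metis exp_ln exp_of_nat_mult)
    also have "\<dots> \<le> P (real (Suc n) * (t / real (Suc n))) i i"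
      using t by (intro diag_power_le) auto
    finally show ?case by simp
  qed
  then show ?thesis
    using tendsto_upperbound[OF tendsto_exp[OF lim]] by simp
qed (simp add: P_zero)

lemma taboo_diag_ge:
  assumes "finite A" "i \<in> A" "\<forall>x\<in>set xs. 0 \<le> x"
  shows "exp (q i i * sum_list xs) \<le> taboo P A xs i i"
  using assms(3)
proof (induction xs)
  case (Cons x xs)
  have "exp (q i i * sum_list (x # xs)) = exp (q i i * x) * exp (q i i * sum_list xs)"
    by (simp add: exp_add[symmetric] algebra_simps)
  also have "\<dots> \<le> P x i i * taboo P A xs i i"
    using Cons by (intro mult_mono diag_ge) (auto simp: P_nonneg)
  also have "\<dots> \<le> (\<Sum>k\<in>A. P x i k * taboo P A xs k i)"
    using assms Cons.prems by (intro member_le_sum) (auto simp: P_nonneg taboo_nonneg)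
  finally show ?case using assms by simp
qed (use assms in auto)

lemma killed_diag_ge:
  assumes "finite A" "i \<in> A" "0 \<le> t"
  shows "exp (q i i * t) \<le> killed P A t i i"
  using taboo_diag_ge[OF assms(1,2)] assms(3) by (intro killed_greatest) (auto simp: partitions_def)

text \<open>Only paths with a single jump are kept.\<close>
lemma taboo_offdiag_ge:
  assumes "finite A" "i \<in> A" "j \<in> A" "i \<noteq> j" "\<forall>x\<in>set xs. 0 \<le> x"
    and "c \<le> q i i" "c \<le> q j j" and r: "\<forall>x\<in>set xs. r * x \<le> P x i j" and r0: "0 \<le> r"
  shows "exp (c * sum_list xs) * (r * sum_list xs) \<le> taboo P A xs i j"
  using assms(5) r
proof (induction xs)
  case (Cons x xs)
  then have nn: "0 \<le> x" "0 \<le> sum_list xs" by (auto intro: sum_list_nonneg)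
  have e: "exp (c * y) \<le> exp (q i i * y)" "exp (c * y) \<le> exp (q j j * y)" if "0 \<le> y" for y
    using assms that by (auto intro: mult_right_mono)
  have c0: "c \<le> 0"
  proof -
    have "exp (q i i * 1) \<le> 1" using diag_ge[of 1 i] P_le_1[of 1 i i] by linarith
    then show ?thesis using assms by auto
  qed
  have "exp (c * sum_list (x # xs)) * (r * sum_list (x # xs))
      = exp (c * x) * (exp (c * sum_list xs) * (r * sum_list xs)) + exp (c * x) * ((r * x) * exp (c * sum_list xs))"
    by (simp add: algebra_simps exp_add)
  also have "\<dots> \<le> P x i i * taboo P A xs i j + P x i j * taboo P A xs j j"
  proof (intro add_mono)
    show "exp (c * x) * (exp (c * sum_list xs) * (r * sum_list xs)) \<le> P x i i * taboo P A xs i j"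
      using Cons nn r0 order_trans[OF e(1) diag_ge, of x] by (intro mult_mono) (auto simp: P_nonneg)
    have "exp (c * x) * ((r * x) * exp (c * sum_list xs)) \<le> (r * x) * exp (c * sum_list xs)"
      using c0 nn r0 by (intro mult_left_le_one_le) (auto simp: mult_nonpos_nonneg)
    also have "\<dots> \<le> P x i j * taboo P A xs j j"
      using Cons nn
      by (intro mult_mono) (auto simp: P_nonneg intro: order_trans[OF e(2) taboo_diag_ge[OF assms(1) assms(3)]])
    finally show "exp (c * x) * ((r * x) * exp (c * sum_list xs)) \<le> P x i j * taboo P A xs j j" .
  qed
  also have "\<dots> = (\<Sum>k\<in>{i,j}. P x i k * taboo P A xs k j)"
    using assms by simp
  also have "\<dots> \<le> (\<Sum>k\<in>A. P x i k * taboo P A xs k j)"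
    using assms(1-4) Cons.prems by (intro sum_mono2) (auto simp: P_nonneg taboo_nonneg)
  finally show ?case using assms by simp
qed (use assms in auto)

text \<open>Here \<open>r\<close> bounds the slope of \<open>P x i j\<close> from below up to time
  \<open>t\<close>. The taboo bound does not depend on the partition, so it survives the
  infimum.\<close>

lemma killed_offdiag_ge:
  assumes "finite A" "i \<in> A" "j \<in> A" "i \<noteq> j" "0 \<le> t"
    and "c \<le> q i i" "c \<le> q j j" and r: "\<And>x. 0 \<le> x \<Longrightarrow> x \<le> t \<Longrightarrow> r * x \<le> P x i j" and "0 \<le> r"
  shows "exp (c * t) * (r * t) \<le> killed P A t i j"
proof (rule killed_greatest)
  fix xs assume xs: "xs \<in> partitions t"
  then have "\<forall>x\<in>set xs. x \<le> t" by (auto simp: partitions_def intro: member_le_sum_list)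
  with xs taboo_offdiag_ge[OF assms(1-4) _ assms(6,7), of xs r] assms
  show "exp (c * t) * (r * t) \<le> taboo P A xs i j" by (auto simp: partitions_def)
qed (use assms in auto)

section \<open>The supremum over finite sets\<close>

lemma bdd_above_killed: "0 \<le> t \<Longrightarrow> bdd_above (range (\<lambda>n. killed P (initial n) t i j))"
  using killed_le[OF finite_initial] by (intro bdd_aboveI2[of _ _ "P t i j"]) auto

lemma minimal_LIMSEQ:
  assumes "0 \<le> t"
  shows "(\<lambda>n. killed P (initial n) t i j) \<longlonglongrightarrow> minimal P t i j"
  unfolding minimal_def using assms
  by (intro LIMSEQ_incseq_SUP bdd_above_killed incseq_SucI killed_mono initial_mono) auto

lemma killed_le_minimal: "0 \<le> t \<Longrightarrow> killed P (initial n) t i j \<le> minimal P t i j"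
  unfolding minimal_def by (intro cSUP_upper bdd_above_killed) auto

lemma minimal_nonneg: "0 \<le> t \<Longrightarrow> 0 \<le> minimal P t i j"
  using killed_le_minimal[of t 0 i j] killed_nonneg[of t "initial 0" i j] by linarith

lemma minimal_le: "0 \<le> t \<Longrightarrow> minimal P t i j \<le> P t i j"
  unfolding minimal_def by (intro cSUP_least killed_le) auto

text \<open>A squeeze: \<open>P\<close> bounds from above, and the killed kernel of a finite set
  containing \<open>i\<close> and \<open>j\<close> bounds from below with the same first-order
  behaviour at 0.\<close>

lemma minimal_deriv: "((\<lambda>t. minimal P t i j) has_real_derivative q i j) (at 0 within {0..})"
proof -
  have Pd: "((\<lambda>t. (P t i j - P 0 i j) / (t - 0)) \<longlongrightarrow> q i j) (at 0 within {0..})"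
    using P_deriv[of i j] by (simp add: has_field_derivative_iff)
  have "eventually (\<lambda>n. i \<in> initial n \<and> j \<in> initial n) sequentially"
    by (intro eventually_conj eventually_initial)
  then obtain n where n: "i \<in> initial n" "j \<in> initial n" by (auto simp: eventually_sequentially)
  have upper: "eventually (\<lambda>t. (minimal P t i j - P 0 i j) / (t - 0) \<le> (P t i j - P 0 i j) / (t - 0))
      (at 0 within {0..})"
    by (auto simp: eventually_at_filter minimal_le intro!: always_eventually divide_right_mono)
  have lim0: "((\<lambda>t. t) \<longlongrightarrow> (0::real)) (at 0 within {0..})" by (rule tendsto_ident_at)
  have "((\<lambda>t. (minimal P t i j - P 0 i j) / (t - 0)) \<longlongrightarrow> q i j) (at 0 within {0..})"
  proof (cases "i = j")
    case True
    have "((\<lambda>t. exp (q i i * t)) has_real_derivative q i i) (at 0 within {0..})"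
      by (auto intro!: derivative_eq_intros)
    then have "((\<lambda>t. (exp (q i i * t) - 1) / (t - 0)) \<longlongrightarrow> q i i) (at 0 within {0..})"
      by (simp add: has_field_derivative_iff)
    moreover have "eventually (\<lambda>t. (exp (q i i * t) - 1) / (t - 0) \<le> (minimal P t i j - P 0 i j) / (t - 0))
        (at 0 within {0..})"
      using True n order_trans[OF killed_diag_ge[OF finite_initial, of i n] killed_le_minimal]
      by (auto simp: eventually_at_filter P_zero intro!: always_eventually divide_right_mono)
    ultimately show ?thesis using True by (intro tendsto_sandwich[OF _ upper _ Pd]) auto
  next
    case False
    define c where "c = min (q i i) (q j j)"
    show ?thesis
    proof (rule order_tendstoI)
      fix a assume a: "a < q i j"
      show "eventually (\<lambda>t. a < (minimal P t i j - P 0 i j) / (t - 0)) (at 0 within {0..})"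
      \<comment> \<open>For \<open>a < 0\<close> nonnegativity suffices; otherwise a slope between
        \<open>a\<close> and \<open>q i j\<close> is nonnegative, as the one-jump bound
        requires.\<close>
      proof (cases "a < 0")
        case True
        have "a < (minimal P t i j - P 0 i j) / (t - 0)" if "0 \<le> t" for t
          using True that False minimal_nonneg[of t i j]
          by (intro less_le_trans[OF True]) (auto simp: P_zero)
        then show ?thesis by (auto simp: eventually_at_filter intro!: always_eventually)
      next
        case a0: False
        define r where "r = (a + q i j) / 2"
        have r: "a < r" "r < q i j" "0 \<le> r" using a a0 by (auto simp: r_def)
        have "eventually (\<lambda>t. r < (P t i j - P 0 i j) / (t - 0)) (at 0 within {0..})"
          by (rule order_tendstoD(1)[OF Pd r(2)])
        then obtain d where d: "0 < d" "\<And>t. 0 < t \<Longrightarrow> t < d \<Longrightarrow> r < (P t i j - P 0 i j) / (t - 0)"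
          by (auto simp: eventually_at dist_real_def)
        have rP: "r * x \<le> P x i j" if "0 \<le> x" "x < d" for x
          using d(2)[of x] that False by (cases "x = 0") (auto simp: P_zero field_simps)
        \<comment> \<open>Killing costs the slope \<open>r\<close> only the factor
          \<open>exp (c * t)\<close>, which tends to 1, so the bound stays above
          \<open>a\<close>.\<close>
        have "((\<lambda>t. exp (c * t) * r) \<longlongrightarrow> exp (c * 0) * r) (at 0 within {0..})"
          by (intro tendsto_intros)
        then have "eventually (\<lambda>t. a < exp (c * t) * r) (at 0 within {0..})"
          using r by (intro order_tendstoD(1)) auto
        moreover have "eventually (\<lambda>t. t < d) (at 0 within {0..})"
          using lim0 d(1) by (rule order_tendstoD)
        moreover have "eventually (\<lambda>t. t \<in> {0..} \<and> t \<noteq> 0) (at (0::real) within {0..})"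
          by (auto simp: eventually_at_filter)
        ultimately show ?thesis
        proof eventually_elim
          case (elim t)
          then have t: "0 < t" by auto
          have "exp (c * t) * (r * t) \<le> killed P (initial n) t i j"
            using False t elim n r by (intro killed_offdiag_ge rP) (auto simp: c_def)
          also have "\<dots> \<le> minimal P t i j" using t by (intro killed_le_minimal) auto
          finally have "exp (c * t) * r \<le> minimal P t i j / t" using t by (simp add: field_simps)
          with elim show ?case using False by (simp add: P_zero)
        qed
      qed
    next
      fix a assume a: "q i j < a"
      have "eventually (\<lambda>t. (P t i j - P 0 i j) / (t - 0) < a) (at 0 within {0..})"
        by (rule order_tendstoD(2)[OF Pd a])
      with upper show "eventually (\<lambda>t. (minimal P t i j - P 0 i j) / (t - 0) < a) (at 0 within {0..})"
        by eventually_elim auto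
    qed
  qed
  moreover have "minimal P 0 i j = P 0 i j"
  proof (cases "i = j")
    case True
    then show ?thesis
      using minimal_le[of 0 i j] order_trans[OF killed_diag_ge[OF finite_initial n(1), of 0] killed_le_minimal]
      by (auto simp: P_zero)
  next
    case False
    then show ?thesis using minimal_le[of 0 i j] minimal_nonneg[of 0 i j] by (simp add: P_zero)
  qed
  ultimately show ?thesis by (simp add: has_field_derivative_iff)
qed

text \<open>Monotone convergence: the killed kernels increase with the finite set, and their finite
  sums are extended by 0 to the whole space.\<close>

lemma minimal_semigroup:
  assumes s: "0 \<le> s" and t: "0 \<le> t"
  shows "ennreal (minimal P (s + t) i j) = esum (\<lambda>k. minimal P s i k * minimal P t k j)"
proof (rule LIMSEQ_unique)
  show "(\<lambda>n. ennreal (killed P (initial n) (s + t) i j)) \<longlonglongrightarrow> ennreal (minimal P (s + t) i j)"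
    using s t by (intro tendsto_ennrealI minimal_LIMSEQ) auto
  have eq: "ennreal (killed P (initial n) (s + t) i j)
      = (\<integral>\<^sup>+ k. ennreal (killed P (initial n) s i k * killed P (initial n) t k j) \<partial>count_space UNIV)" for n
    unfolding killed_semigroup[OF finite_initial s t] esum_def[symmetric]
    using s t by (intro esum_finite_support[symmetric]) (auto simp: killed_nonneg killed_outside2)
  show "(\<lambda>n. ennreal (killed P (initial n) (s + t) i j)) \<longlonglongrightarrow> esum (\<lambda>k. minimal P s i k * minimal P t k j)"
    unfolding eq esum_def using s t
    by (intro nn_integral_LIMSEQ incseq_SucI le_funI ennreal_leI mult_mono killed_mono killed_nonneg
        tendsto_ennrealI tendsto_mult minimal_LIMSEQ) (auto intro!: initial_mono)
qed

lemma minimal_q_process: "q_process q (minimal P)"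
proof -
  have "esum (minimal P t i) \<le> 1" if "0 \<le> t" for t i
  proof -
    have "esum (minimal P t i) \<le> esum (P t i)"
      unfolding esum_def using that by (intro nn_integral_mono ennreal_leI minimal_le)
    with P_substochastic[OF that, of i] show ?thesis by simp
  qed
  moreover have "minimal P 0 i j = (if i = j then 1 else 0)" for i j
  proof (cases "i = j")
    case True
    obtain n where "i \<in> initial n" using eventually_initial[of i] by (auto simp: eventually_sequentially)
    from order_trans[OF killed_diag_ge[OF finite_initial this, of 0] killed_le_minimal] True
    show ?thesis using minimal_le[of 0 i j] by (auto simp: P_zero)
  next
    case False
    then show ?thesis using minimal_le[of 0 i j] minimal_nonneg[of 0 i j] by (simp add: P_zero)
  qed
  ultimately show ?thesis
    unfolding q_process_def using minimal_nonneg minimal_semigroup minimal_deriv by blast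
qed

end

section \<open>Reversible kernels\<close>

abbreviation bounded_fun :: "('a \<Rightarrow> real) \<Rightarrow> bool" where
  "bounded_fun u \<equiv> bounded (range u)"

lemma bounded_funE:
  assumes "bounded_fun u"
  obtains c where "0 < c" "\<And>x. \<bar>u x\<bar> \<le> c"
  using assms unfolding bounded_pos by auto

lemma bounded_funI: "(\<And>x. \<bar>u x\<bar> \<le> c) \<Longrightarrow> bounded_fun u"
  by (rule boundedI[of _ c]) auto

lemma bounded_fun_mult [intro, simp]:
  assumes "bounded_fun u" "bounded_fun w" shows "bounded_fun (\<lambda>x. u x * w x)"
proof -
  obtain c where c: "0 < c" "\<And>x. \<bar>u x\<bar> \<le> c" using assms(1) by (metis bounded_funE)
  obtain d where d: "0 < d" "\<And>x. \<bar>w x\<bar> \<le> d" using assms(2) by (metis bounded_funE)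
  have "\<bar>u x * w x\<bar> \<le> c * d" for x
    unfolding abs_mult using c d by (intro mult_mono) auto
  then show ?thesis by (rule bounded_funI)
qed

lemma bounded_fun_const [intro, simp]: "bounded_fun (\<lambda>_. c)"
  by (rule bounded_funI[of _ "\<bar>c\<bar>"]) auto

lemma bounded_fun_diff [intro, simp]:
  "bounded_fun u \<Longrightarrow> bounded_fun w \<Longrightarrow> bounded_fun (\<lambda>x. u x - w x)"
  using bounded_minus_comp[of u UNIV w] by simp

lemma bounded_fun_add [intro, simp]:
  "bounded_fun u \<Longrightarrow> bounded_fun w \<Longrightarrow> bounded_fun (\<lambda>x. u x + w x)"
  using bounded_plus_comp[of u UNIV w] by simp

lemma bounded_fun_power2 [intro, simp]: "bounded_fun u \<Longrightarrow> bounded_fun (\<lambda>x. (u x)\<^sup>2)"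
  unfolding power2_eq_square by simp

lemma bounded_fun_compose [intro]: "bounded_fun u \<Longrightarrow> bounded_fun (\<lambda>x. u (g x))"
  by (rule bounded_subset[of "range u"]) auto

lemma bounded_fun_fst [intro, simp]: "bounded_fun u \<Longrightarrow> bounded_fun (\<lambda>x. u (fst x))"
  by (rule bounded_fun_compose)

lemma bounded_fun_snd [intro, simp]: "bounded_fun u \<Longrightarrow> bounded_fun (\<lambda>x. u (snd x))"
  by (rule bounded_fun_compose)

lemma integrable_bounded_pmf [intro, simp]:
  "bounded_fun u \<Longrightarrow> integrable (measure_pmf p) u"
  by (erule bounded_funE) (rule measure_pmf.integrable_const_bound, auto)

definition avg :: "('a \<Rightarrow> 'b pmf) \<Rightarrow> ('b \<Rightarrow> real) \<Rightarrow> 'a \<Rightarrow> real" where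
  "avg K u i = measure_pmf.expectation (K i) u"

lemma abs_expectation_pmf_le:
  fixes u :: "'a \<Rightarrow> real"
  assumes "\<And>x. \<bar>u x\<bar> \<le> c"
  shows "\<bar>measure_pmf.expectation p u\<bar> \<le> c"
proof -
  have "\<bar>measure_pmf.expectation p u\<bar> \<le> measure_pmf.expectation p (\<lambda>x. \<bar>u x\<bar>)"
    using integral_norm_bound[of p u] by simp
  also have "\<dots> \<le> measure_pmf.expectation p (\<lambda>_. c)"
    using assms order_trans[OF abs_ge_zero assms]
    by (intro integral_mono integrable_bounded_pmf bounded_funI[of _ c]) auto
  finally show ?thesis by simp
qed

lemma bounded_fun_avg [intro, simp]:
  assumes "bounded_fun u" shows "bounded_fun (avg K u)"
proof -
  obtain c where c: "\<And>x. \<bar>u x\<bar> \<le> c" using assms by (metis bounded_funE)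
  then show ?thesis by (auto simp: avg_def intro!: bounded_funI[of _ c] abs_expectation_pmf_le)
qed

lemma expectation_bind_pmf:
  assumes "bounded_fun u"
  shows "measure_pmf.expectation (bind_pmf p K) u = measure_pmf.expectation p (avg K u)"
proof -
  obtain c where c: "0 < c" "\<And>x. \<bar>u x\<bar> \<le> c" using assms by (metis bounded_funE)
  \<comment> \<open>Adding \<open>c\<close> makes the integrand nonnegative, so that the rule for
    nonnegative integrals over \<open>bind_pmf\<close> applies; the constant cancels at the
    end.\<close>
  define w where "w x = u x + c" for x
  have w: "bounded_fun w" using assms unfolding w_def by auto
  have w': "0 \<le> w x" for x using c(2)[of x] unfolding w_def by linarith
  have nn: "(\<integral>\<^sup>+ x. ennreal (w x) \<partial>measure_pmf r) = ennreal (measure_pmf.expectation r w)" for r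
    using w w' by (intro nn_integral_eq_integral) auto
  have "ennreal (measure_pmf.expectation (bind_pmf p K) w) = (\<integral>\<^sup>+ x. ennreal (avg K w x) \<partial>measure_pmf p)"
    by (simp add: nn[symmetric] avg_def)
  also have "\<dots> = ennreal (measure_pmf.expectation p (avg K w))"
    using w w' by (intro nn_integral_eq_integral integrable_bounded_pmf bounded_fun_avg) (auto simp: avg_def)
  finally have "measure_pmf.expectation (bind_pmf p K) w = measure_pmf.expectation p (avg K w)"
    using w' by (auto simp: avg_def intro!: integral_nonneg)
  moreover have "avg K w = (\<lambda>i. avg K u i + c)"
    using assms by (auto simp: avg_def w_def[abs_def])
  ultimately show ?thesis using assms by (simp add: w_def[abs_def])
qed

lemma avg_avg:
  assumes "bounded_fun u"
  shows "avg K (avg L u) i = avg (\<lambda>i. bind_pmf (K i) L) u i"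
  using expectation_bind_pmf[OF assms, of "K i" L] by (simp add: avg_def[of K] avg_def[of "\<lambda>i. bind_pmf (K i) L"])

text \<open>Joint law of a starting point drawn from \<open>p\<close> and the state after one step
  of \<open>K\<close>.\<close>

definition transitions :: "'a pmf \<Rightarrow> ('a \<Rightarrow> 'b pmf) \<Rightarrow> ('a \<times> 'b) pmf" where
  "transitions p K = bind_pmf p (\<lambda>i. map_pmf (Pair i) (K i))"

lemma pmf_transitions: "pmf (transitions p K) (i, j) = pmf p i * pmf (K i) j"
proof -
  have "pmf (map_pmf (Pair x) (K x)) (i, j) = (if x = i then pmf (K i) j else 0)" for x
  proof (cases "x = i")
    case True
    then show ?thesis using pmf_map_inj'[of "Pair i" "K i" j] by (simp add: inj_def)
  next
    case False
    then show ?thesis by (auto simp: pmf_eq_0_set_pmf)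
  qed
  then have "pmf (transitions p K) (i, j) = measure_pmf.expectation p (\<lambda>x. if x = i then pmf (K i) j else 0)"
    by (simp add: transitions_def pmf_bind)
  also have "\<dots> = pmf p i * pmf (K i) j"
    by (subst integral_measure_pmf[of "{i}"]) (auto split: if_splits)
  finally show ?thesis .
qed

lemma expectation_transitions:
  assumes "bounded_fun w"
  shows "measure_pmf.expectation (transitions p K) w
    = measure_pmf.expectation p (\<lambda>i. measure_pmf.expectation (K i) (\<lambda>j. w (i, j)))"
  unfolding transitions_def by (subst expectation_bind_pmf[OF assms]) (simp add: avg_def[abs_def])

section \<open>Reversibility as symmetry of the joint law\<close>

definition reversible_kernel :: "'a pmf \<Rightarrow> ('a \<Rightarrow> 'a pmf) \<Rightarrow> bool" where
  "reversible_kernel p K \<longleftrightarrow> (\<forall>i j. pmf p i * pmf (K i) j = pmf p j * pmf (K j) i)"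

lemma transitions_swap:
  assumes "reversible_kernel p K"
  shows "map_pmf prod.swap (transitions p K) = transitions p K"
proof (rule pmf_eqI)
  fix ij :: "'a \<times> 'a"
  obtain i j where ij: "ij = prod.swap (j, i)" by (cases ij) auto
  have "pmf (map_pmf prod.swap (transitions p K)) ij = pmf (transitions p K) (j, i)"
    unfolding ij by (rule pmf_map_inj') simp
  then show "pmf (map_pmf prod.swap (transitions p K)) ij = pmf (transitions p K) ij"
    using assms ij by (simp add: pmf_transitions reversible_kernel_def)
qed

lemma expectation_mult_avg:
  assumes "bounded_fun u" "bounded_fun w"
  shows "measure_pmf.expectation p (\<lambda>i. u i * avg K w i)
    = measure_pmf.expectation (transitions p K) (\<lambda>ij. u (fst ij) * w (snd ij))"
  by (subst expectation_transitions) (use assms in \<open>auto simp: avg_def\<close>)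

lemma expectation_transitions_swap:
  fixes w :: "'a \<times> 'a \<Rightarrow> real"
  assumes "reversible_kernel p K"
  shows "measure_pmf.expectation (transitions p K) w
    = measure_pmf.expectation (transitions p K) (\<lambda>ij. w (prod.swap ij))"
proof -
  have "measure_pmf.expectation (transitions p K) w
      = measure_pmf.expectation (map_pmf prod.swap (transitions p K)) w"
    by (simp only: transitions_swap[OF assms])
  then show ?thesis by simp
qed

text \<open>Self-adjointness: exchanging the two coordinates of the joint law exchanges the roles of
  \<open>u\<close> and \<open>w\<close>.\<close>

lemma avg_symmetric:
  assumes "reversible_kernel p K" "bounded_fun u" "bounded_fun w"
  shows "measure_pmf.expectation p (\<lambda>i. u i * avg K w i) = measure_pmf.expectation p (\<lambda>i. avg K u i * w i)"
proof -
  have "measure_pmf.expectation p (\<lambda>i. u i * avg K w i)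
      = measure_pmf.expectation (transitions p K) (\<lambda>ij. w (fst ij) * u (snd ij))"
    using assms expectation_transitions_swap[OF assms(1), of "\<lambda>ij. u (fst ij) * w (snd ij)"]
    by (simp add: expectation_mult_avg mult.commute)
  also have "\<dots> = measure_pmf.expectation p (\<lambda>i. w i * avg K u i)"
    using assms by (simp add: expectation_mult_avg)
  finally show ?thesis by (simp add: mult.commute)
qed

lemma expectation_avg:
  assumes "reversible_kernel p K" "bounded_fun u"
  shows "measure_pmf.expectation p (avg K u) = measure_pmf.expectation p u"
  using avg_symmetric[OF assms(1), of "\<lambda>_. 1" u] assms by (simp add: avg_def[of K "\<lambda>_. 1"])

lemma reversible_kernel_square:
  assumes "reversible_kernel p K"
  shows "reversible_kernel p (\<lambda>i. bind_pmf (K i) K)"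
  unfolding reversible_kernel_def
proof (intro allI)
  fix i j
  let ?d = "\<lambda>i x. indicator {i} x :: real"
  have [simp]: "bounded_fun (?d i)" for i by (rule bounded_funI[of _ 1]) (auto simp: indicator_def)
  have pmf_avg: "avg L (?d j) i = pmf (L i) j" for L :: "'a \<Rightarrow> 'a pmf" and i j
    by (simp add: avg_def pmf.rep_eq)
  have pt: "measure_pmf.expectation p (\<lambda>x. ?d i x * v x) = pmf p i * v i" for v i
    by (subst integral_measure_pmf[of "{i}"]) (auto simp: indicator_def split: if_splits)
  \<comment> \<open>Entries are pairings with indicators. Self-adjointness moves one of the two
    averagings to the other side, and the resulting inner product is symmetric in \<open>i\<close>
    and \<open>j\<close>.\<close>
  have eq: "pmf p i * pmf (bind_pmf (K i) K) j = measure_pmf.expectation p (\<lambda>x. avg K (?d i) x * avg K (?d j) x)" for i j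
  proof -
    have "pmf p i * pmf (bind_pmf (K i) K) j = measure_pmf.expectation p (\<lambda>x. ?d i x * avg K (avg K (?d j)) x)"
      unfolding pt by (simp add: avg_avg pmf_avg)
    also have "\<dots> = measure_pmf.expectation p (\<lambda>x. avg K (?d i) x * avg K (?d j) x)"
      by (intro avg_symmetric assms) auto
    finally show ?thesis .
  qed
  show "pmf p i * pmf (bind_pmf (K i) K) j = pmf p j * pmf (bind_pmf (K j) K) i"
    unfolding eq by (simp add: mult.commute)
qed

section \<open>Energy of a kernel and of its powers\<close>

definition energy :: "'a pmf \<Rightarrow> ('a \<Rightarrow> 'a pmf) \<Rightarrow> ('a \<Rightarrow> real) \<Rightarrow> real" where
  "energy p K u = measure_pmf.expectation p (\<lambda>i. (u i)\<^sup>2) - measure_pmf.expectation p (\<lambda>i. u i * avg K u i)"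

text \<open>When the square is expanded, the two squared terms have the same expectation because the
  joint law is symmetric.\<close>

lemma energy_eq:
  assumes "reversible_kernel p K" "bounded_fun u"
  shows "energy p K u = measure_pmf.expectation (transitions p K) (\<lambda>ij. (u (snd ij) - u (fst ij))\<^sup>2 / 2)"
proof -
  let ?E = "measure_pmf.expectation (transitions p K)"
  have sq: "?E (\<lambda>ij. (u (fst ij))\<^sup>2) = measure_pmf.expectation p (\<lambda>i. (u i)\<^sup>2)"
    by (subst expectation_transitions) (use assms in auto)
  then have sq': "?E (\<lambda>ij. (u (snd ij))\<^sup>2) = measure_pmf.expectation p (\<lambda>i. (u i)\<^sup>2)"
    using expectation_transitions_swap[OF assms(1), of "\<lambda>ij. (u (snd ij))\<^sup>2"] by simp
  have "?E (\<lambda>ij. (u (snd ij) - u (fst ij))\<^sup>2 / 2)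
      = ?E (\<lambda>ij. ((u (snd ij))\<^sup>2 + (u (fst ij))\<^sup>2) / 2 - u (fst ij) * u (snd ij))"
    by (intro Bochner_Integration.integral_cong) (auto simp: power2_eq_square field_simps)
  also have "\<dots> = (?E (\<lambda>ij. (u (snd ij))\<^sup>2) + ?E (\<lambda>ij. (u (fst ij))\<^sup>2)) / 2 - ?E (\<lambda>ij. u (fst ij) * u (snd ij))"
    using assms by (subst Bochner_Integration.integral_diff) auto
  finally show ?thesis
    using assms by (simp add: energy_def sq sq' expectation_mult_avg)
qed

text \<open>This form has the shape of \<open>dirichlet\<close>, with kernel entries in place of
  jump rates, so the two can be compared term by term.\<close>

lemma energy_nn_integral:
  assumes "reversible_kernel p K" "bounded_fun u"
  shows "ennreal (energy p K u)
    = (\<integral>\<^sup>+ ij. ennreal (pmf p (fst ij) * pmf (K (fst ij)) (snd ij) * (u (snd ij) - u (fst ij))\<^sup>2 / 2) \<partial>count_space UNIV)"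
proof -
  have "ennreal (energy p K u)
      = (\<integral>\<^sup>+ ij. ennreal ((u (snd ij) - u (fst ij))\<^sup>2 / 2) \<partial>measure_pmf (transitions p K))"
    unfolding energy_eq[OF assms] using assms by (intro nn_integral_eq_integral[symmetric]) auto
  also have "\<dots> = (\<integral>\<^sup>+ ij. ennreal (pmf p (fst ij) * pmf (K (fst ij)) (snd ij) * (u (snd ij) - u (fst ij))\<^sup>2 / 2) \<partial>count_space UNIV)"
    unfolding nn_integral_measure_pmf
    by (intro nn_integral_cong) (auto simp: pmf_transitions ennreal_mult[symmetric] split_beta)
  finally show ?thesis .
qed

lemma energy_nonneg:
  assumes "reversible_kernel p K" "bounded_fun u"
  shows "0 \<le> energy p K u"
  unfolding energy_eq[OF assms] by simp

text \<open>With \<open>T\<close> the self-adjoint averaging operator, \<open>(u - TTu, u) = 2 (u - Tu, u) - (u - Tu, u - Tu)\<close>.\<close>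
lemma energy_square_le:
  assumes "reversible_kernel p K" "bounded_fun u"
  shows "energy p (\<lambda>i. bind_pmf (K i) K) u \<le> 2 * energy p K u"
proof -
  let ?E = "measure_pmf.expectation p"
  have "?E (\<lambda>i. u i * avg (\<lambda>i. bind_pmf (K i) K) u i) = ?E (\<lambda>i. avg K u i * avg K u i)"
    using avg_symmetric[OF assms(1,2), of "avg K u"] assms by (simp add: avg_avg[symmetric])
  moreover have "0 \<le> ?E (\<lambda>i. (u i - avg K u i)\<^sup>2)" by simp
  moreover have "?E (\<lambda>i. (u i - avg K u i)\<^sup>2) = ?E (\<lambda>i. (u i)\<^sup>2 + avg K u i * avg K u i - 2 * (u i * avg K u i))"
    by (intro Bochner_Integration.integral_cong) (auto simp: power2_eq_square algebra_simps)
  moreover have "\<dots> = ?E (\<lambda>i. (u i)\<^sup>2) + ?E (\<lambda>i. avg K u i * avg K u i) - 2 * ?E (\<lambda>i. u i * avg K u i)"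
    using assms by (subst Bochner_Integration.integral_diff) auto
  ultimately show ?thesis by (simp add: energy_def)
qed

text \<open>The kernel of \<open>2 ^ n\<close> steps, arranged by repeated squaring to match the
  energy inequality for a square.\<close>

fun doubling :: "('a \<Rightarrow> 'a pmf) \<Rightarrow> nat \<Rightarrow> 'a \<Rightarrow> 'a pmf" where
  "doubling K 0 = K"
| "doubling K (Suc n) = (\<lambda>i. bind_pmf (doubling K n i) (doubling K n))"

lemma reversible_doubling: "reversible_kernel p K \<Longrightarrow> reversible_kernel p (doubling K n)"
  by (induction n) (auto intro: reversible_kernel_square)

lemma energy_doubling_le:
  assumes "reversible_kernel p K" "bounded_fun u"
  shows "energy p (doubling K n) u \<le> 2 ^ n * energy p K u"
proof (induction n)
  case (Suc n)
  have "energy p (doubling K (Suc n)) u \<le> 2 * energy p (doubling K n) u"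
    using assms by (simp add: energy_square_le reversible_doubling)
  with Suc show ?case by simp
qed simp

text \<open>Each of the two expectations lies within \<open>c\<close> times the mass not covered by
  \<open>G\<close> on \<open>A\<close> of the sum of \<open>G j * u j\<close>.\<close>

lemma expectation_common_part:
  assumes A: "finite A" and G: "\<And>j. 0 \<le> G j" "\<And>j. G j \<le> pmf p j" "\<And>j. G j \<le> pmf p' j"
    and u: "\<And>x. \<bar>u x\<bar> \<le> c"
  shows "\<bar>measure_pmf.expectation p u - measure_pmf.expectation p' u\<bar> \<le> 2 * c * (1 - (\<Sum>j\<in>A. G j))"
proof -
  have c0: "0 \<le> c" using u[of undefined] by linarith
  have bu: "bounded_fun u" using u by (rule bounded_funI)
  have *: "\<bar>measure_pmf.expectation r u - (\<Sum>j\<in>A. G j * u j)\<bar> \<le> c * (1 - (\<Sum>j\<in>A. G j))"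
    if r: "\<And>j. G j \<le> pmf r j" for r
  proof -
    have bi: "bounded_fun (indicator B :: _ \<Rightarrow> real)" for B :: "'a set"
      by (rule bounded_funI[of _ 1]) (auto simp: indicator_def)
    have "measure_pmf.expectation r u = measure_pmf.expectation r (\<lambda>x. u x * indicator A x)
        + measure_pmf.expectation r (\<lambda>x. u x * indicator (-A) x)"
      using bu bi by (subst Bochner_Integration.integral_add[symmetric], simp, simp)
        (auto simp: indicator_def intro!: Bochner_Integration.integral_cong)
    moreover have "measure_pmf.expectation r (\<lambda>x. u x * indicator A x) = (\<Sum>j\<in>A. pmf r j * u j)"
      using A by (subst integral_measure_pmf[of A]) (auto simp: indicator_def)
    moreover have "\<bar>measure_pmf.expectation r (\<lambda>x. u x * indicator (-A) x)\<bar> \<le> c * (1 - (\<Sum>j\<in>A. pmf r j))"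
    proof -
      have "\<bar>measure_pmf.expectation r (\<lambda>x. u x * indicator (-A) x)\<bar>
          \<le> measure_pmf.expectation r (\<lambda>x. \<bar>u x * indicator (-A) x\<bar>)"
        using integral_norm_bound[of r "\<lambda>x. u x * indicator (-A) x"] by simp
      also have "\<dots> \<le> measure_pmf.expectation r (\<lambda>x. c * indicator (-A) x)"
        using bu bi u c0 by (intro integral_mono integrable_abs integrable_bounded_pmf bounded_fun_mult
            bounded_fun_const bi) (auto simp: indicator_def)
      also have "\<dots> = c * measure_pmf.prob r (-A)" by simp
      also have "measure_pmf.prob r (-A) = 1 - (\<Sum>j\<in>A. pmf r j)"
        using A by (simp add: measure_pmf.prob_compl[of A, simplified] Compl_eq_Diff_UNIV measure_measure_pmf_finite)
      finally show ?thesis .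
    qed
    moreover have "\<bar>(\<Sum>j\<in>A. pmf r j * u j) - (\<Sum>j\<in>A. G j * u j)\<bar> \<le> c * ((\<Sum>j\<in>A. pmf r j) - (\<Sum>j\<in>A. G j))"
    proof -
      have "\<bar>(\<Sum>j\<in>A. pmf r j * u j) - (\<Sum>j\<in>A. G j * u j)\<bar> = \<bar>\<Sum>j\<in>A. (pmf r j - G j) * u j\<bar>"
        by (simp add: sum_subtractf algebra_simps)
      also have "\<dots> \<le> (\<Sum>j\<in>A. \<bar>(pmf r j - G j) * u j\<bar>)" by (rule sum_abs)
      also have "\<dots> \<le> (\<Sum>j\<in>A. (pmf r j - G j) * c)"
        using r u by (intro sum_mono) (auto simp: abs_mult intro!: mult_left_mono)
      also have "\<dots> = c * ((\<Sum>j\<in>A. pmf r j) - (\<Sum>j\<in>A. G j))"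
        by (simp only: sum_subtractf[symmetric] sum_distrib_left mult.commute)
      finally show ?thesis .
    qed
    ultimately show ?thesis by (simp add: algebra_simps abs_if split: if_splits)
  qed
  show ?thesis using *[of p] *[of p'] G by (simp add: algebra_simps abs_if split: if_splits)
qed

lemma expectation_Cauchy_Schwarz:
  assumes "bounded_fun u" "bounded_fun w"
  shows "(measure_pmf.expectation p (\<lambda>x. u x * w x))\<^sup>2
    \<le> measure_pmf.expectation p (\<lambda>x. (u x)\<^sup>2) * measure_pmf.expectation p (\<lambda>x. (w x)\<^sup>2)"
proof -
  let ?E = "measure_pmf.expectation p"
  have sq: "(\<integral>\<^sup>+ x. (ennreal \<bar>v x\<bar>)\<^sup>2 \<partial>measure_pmf p) = ennreal (?E (\<lambda>x. (v x)\<^sup>2))"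
    if "bounded_fun v" for v
    using that by (subst nn_integral_eq_integral[symmetric]) (auto simp: ennreal_power)
  have "\<bar>?E (\<lambda>x. u x * w x)\<bar> \<le> ?E (\<lambda>x. \<bar>u x * w x\<bar>)"
    using integral_norm_bound[of p "\<lambda>x. u x * w x"] by simp
  moreover have "ennreal (?E (\<lambda>x. \<bar>u x * w x\<bar>)) = (\<integral>\<^sup>+ x. ennreal \<bar>u x\<bar> * ennreal \<bar>w x\<bar> \<partial>measure_pmf p)"
    using assms by (subst nn_integral_eq_integral[symmetric])
      (auto simp: ennreal_mult[symmetric] abs_mult[symmetric] intro!: nn_integral_cong integrable_abs)
  moreover have "(\<integral>\<^sup>+ x. ennreal \<bar>u x\<bar> * ennreal \<bar>w x\<bar> \<partial>measure_pmf p)\<^sup>2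
      \<le> ennreal (?E (\<lambda>x. (u x)\<^sup>2) * ?E (\<lambda>x. (w x)\<^sup>2))"
    using Cauchy_Schwarz_nn_integral[of "\<lambda>x. ennreal \<bar>u x\<bar>" "measure_pmf p" "\<lambda>x. ennreal \<bar>w x\<bar>"]
      sq[OF assms(1)] sq[OF assms(2)] by (simp add: ennreal_mult)
  ultimately have "ennreal ((?E (\<lambda>x. \<bar>u x * w x\<bar>))\<^sup>2) \<le> ennreal (?E (\<lambda>x. (u x)\<^sup>2) * ?E (\<lambda>x. (w x)\<^sup>2))"
    and le: "\<bar>?E (\<lambda>x. u x * w x)\<bar> \<le> ?E (\<lambda>x. \<bar>u x * w x\<bar>)"
    by (simp_all only: ennreal_power[symmetric] Bochner_Integration.integral_nonneg abs_ge_zero)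
  then have "(?E (\<lambda>x. \<bar>u x * w x\<bar>))\<^sup>2 \<le> ?E (\<lambda>x. (u x)\<^sup>2) * ?E (\<lambda>x. (w x)\<^sup>2)" by simp
  with power_mono[OF le abs_ge_zero, of 2] show ?thesis by simp
qed

section \<open>Decay at the rate of the spectral gap\<close>

text \<open>A Gronwall argument in which monotonicity of \<open>y\<close> takes the place of
  continuity. For \<open>c' < c\<close> the bound still holds at the supremum of the times where it
  holds, and one small step would lead beyond that supremum.\<close>

lemma exponential_decay_from_steps:
  fixes y :: "real \<Rightarrow> real" and s :: "nat \<Rightarrow> real"
  assumes nonneg: "\<And>t. 0 \<le> t \<Longrightarrow> 0 \<le> y t"
    and antimono: "\<And>r h. 0 \<le> r \<Longrightarrow> 0 \<le> h \<Longrightarrow> y (r + h) \<le> y r"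
    and s: "\<And>n. 0 < s n" "s \<longlonglongrightarrow> 0"
    and step: "\<And>r c'. 0 \<le> r \<Longrightarrow> c' < c \<Longrightarrow> eventually (\<lambda>n. y (r + s n) \<le> (1 - c' * s n) * y r) sequentially"
    and R: "0 \<le> R"
  shows "y R \<le> exp (- c * R) * y 0"
proof -
  have main: "y R \<le> exp (- c' * R) * y 0" if c': "c' < c" for c'
  proof -
    define B where "B = {r \<in> {0..R}. y r \<le> exp (- c' * r) * y 0}"
    define T where "T = Sup B"
    have B: "0 \<in> B" "bdd_above B" using R by (auto simp: B_def intro!: bdd_aboveI[of _ R])
    have le_T: "b \<le> T" if "b \<in> B" for b unfolding T_def using that B by (intro cSup_upper)
    have T: "0 \<le> T" "T \<le> R"
      using le_T[OF B(1)] B(1) by (auto simp: T_def B_def intro!: cSup_least)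
    have "T \<in> closure B" unfolding T_def using B by (intro closure_contains_Sup) auto
    then obtain b where b: "\<And>n. b n \<in> B" "b \<longlonglongrightarrow> T" by (auto simp: closure_sequential)
    \<comment> \<open>Each \<open>b n\<close> is at most \<open>T\<close>, so monotonicity carries
      its bound to \<open>T\<close>; the limit then puts \<open>T\<close> into the exponent.\<close>
    have "y T \<le> exp (- c' * b n) * y 0" for n
      using antimono[of "b n" "T - b n"] b(1)[of n] le_T[OF b(1)[of n]] by (auto simp: B_def)
    moreover have "(\<lambda>n. exp (- c' * b n) * y 0) \<longlonglongrightarrow> exp (- c' * T) * y 0"
      by (intro tendsto_intros b)
    ultimately have yT: "y T \<le> exp (- c' * T) * y 0" by (intro LIMSEQ_le_const) auto
    have "T = R"
    proof (rule ccontr)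
      assume "T \<noteq> R"
      with T have "0 < R - T" by simp
      with s(2) have "eventually (\<lambda>n. s n < R - T) sequentially" by (rule order_tendstoD)
      with step[OF T(1) c'] have "eventually (\<lambda>n. y (T + s n) \<le> (1 - c' * s n) * y T \<and> s n < R - T) sequentially"
        by eventually_elim auto
      then obtain n where n: "y (T + s n) \<le> (1 - c' * s n) * y T" "s n < R - T"
        by (auto simp: eventually_sequentially)
      \<comment> \<open>The inequality \<open>1 - x \<le> exp (- x)\<close> turns the linear step
        into exponential decay, so \<open>T + s n\<close> would belong to \<open>B\<close>.\<close>
      have "(1 - c' * s n) * y T \<le> exp (- c' * s n) * y T"
        using exp_ge_add_one_self[of "- c' * s n"] nonneg[OF T(1)] by (intro mult_right_mono) auto
      also have "\<dots> \<le> exp (- c' * s n) * (exp (- c' * T) * y 0)" using yT by simp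
      also have "\<dots> = exp (- c' * (T + s n)) * y 0" by (simp add: exp_add[symmetric] algebra_simps)
      finally have "T + s n \<in> B" using n T s(1)[of n] by (auto simp: B_def)
      from le_T[OF this] s(1)[of n] show False by simp
    qed
    with yT show ?thesis by simp
  qed
  \<comment> \<open>Now let \<open>c'\<close> increase to \<open>c\<close>.\<close>
  have "y R \<le> exp (- (c - inverse (real (Suc n))) * R) * y 0" for n by (rule main) simp
  moreover have "(\<lambda>n. exp (- (c - inverse (real (Suc n))) * R) * y 0) \<longlonglongrightarrow> exp (- (c - 0) * R) * y 0"
    by (intro tendsto_intros LIMSEQ_inverse_real_of_nat)
  ultimately show ?thesis by (intro LIMSEQ_le_const[of _ "exp (- c * R) * y 0"]) auto
qed

section \<open>Sums as expectations, and scaling\<close>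

lemma infsum_pmf:
  fixes g :: "'a \<Rightarrow> real"
  assumes "integrable (measure_pmf p) g"
  shows "infsum (\<lambda>i. pmf p i * g i) UNIV = measure_pmf.expectation p g"
proof -
  have "integrable (count_space UNIV) (\<lambda>i. pmf p i * g i)"
    using assms unfolding measure_pmf_eq_density by (subst (asm) integrable_density) auto
  then have "infsetsum (\<lambda>i. pmf p i * g i) UNIV = infsum (\<lambda>i. pmf p i * g i) UNIV"
    by (intro infsetsum_infsum) (simp add: abs_summable_on_def)
  moreover have "measure_pmf.expectation p g = infsetsum (\<lambda>i. pmf p i * g i) UNIV"
    unfolding infsetsum_def measure_pmf_eq_density by (subst integral_density) simp_all
  ultimately show ?thesis by simp
qed

lemma esum_pmf:
  assumes "\<And>i. 0 \<le> h i"
  shows "esum (\<lambda>i. pmf p i * h i) = (\<integral>\<^sup>+ i. ennreal (h i) \<partial>measure_pmf p)"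
  unfolding esum_def nn_integral_measure_pmf using assms
  by (intro nn_integral_cong) (simp add: ennreal_mult)

lemma dirichlet_scale:
  "dirichlet q p (\<lambda>i. a * u i) = ennreal (a\<^sup>2) * dirichlet q p u"
proof -
  have "(if fst ij = snd ij then 0 else p (fst ij) * q (fst ij) (snd ij) * (a * u (snd ij) - a * u (fst ij))\<^sup>2 / 2)
    = a\<^sup>2 * (if fst ij = snd ij then 0 else p (fst ij) * q (fst ij) (snd ij) * (u (snd ij) - u (fst ij))\<^sup>2 / 2)" for ij
    by (simp add: right_diff_distrib[symmetric] power_mult_distrib)
  then show ?thesis
    unfolding dirichlet_def by (subst nn_integral_cmult[symmetric]) (auto simp: ennreal_mult')
qed

lemma ennreal_power2_le_imp_le:
  assumes "x\<^sup>2 \<le> (ennreal b)\<^sup>2" "0 \<le> b"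
  shows "x \<le> ennreal b"
proof (cases x)
  case (real r)
  then have "r\<^sup>2 \<le> b\<^sup>2" using assms by (simp add: ennreal_power)
  then show ?thesis using real assms by (auto intro!: ennreal_leI power2_le_imp_le)
next
  case top
  then show ?thesis using assms by (simp add: ennreal_power top_unique)
qed

text \<open>Uniqueness of the process enters in the form \<open>minimal_eq\<close>.\<close>

locale reversible_chain = q_transition q P
  for q :: "'a::countable \<Rightarrow> 'a \<Rightarrow> real" and P :: "real \<Rightarrow> 'a \<Rightarrow> 'a \<Rightarrow> real" +
  fixes p :: "'a pmf"
  assumes honest: "0 \<le> t \<Longrightarrow> esum (P t i) = 1"
    and minimal_eq: "0 \<le> t \<Longrightarrow> minimal P t i j = P t i j"
    and pmf_pos: "0 < pmf p i"
    and detailed_balance: "0 \<le> t \<Longrightarrow> pmf p i * P t i j = pmf p j * P t j i"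
begin

section \<open>The chain as a family of reversible kernels\<close>

abbreviation E :: "('a \<Rightarrow> real) \<Rightarrow> real" where
  "E \<equiv> measure_pmf.expectation p"

definition K :: "real \<Rightarrow> 'a \<Rightarrow> 'a pmf" where
  "K t i = embed_pmf (P t i)"

lemma pmf_K: "0 \<le> t \<Longrightarrow> pmf (K t i) j = P t i j"
  unfolding K_def using honest[of t i] by (intro pmf_embed_pmf) (auto simp: P_nonneg esum_def)

lemma K_add:
  assumes "0 \<le> s" "0 \<le> t"
  shows "K (s + t) i = bind_pmf (K s i) (K t)"
proof (rule pmf_eqI)
  fix j
  have "ennreal (pmf (bind_pmf (K s i) (K t)) j) = ennreal (pmf (K (s + t) i) j)"
    unfolding ennreal_pmf_bind nn_integral_measure_pmf
    using assms by (simp add: pmf_K chapman_kolmogorov esum_def ennreal_mult P_nonneg)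
  then show "pmf (K (s + t) i) j = pmf (bind_pmf (K s i) (K t)) j" by simp
qed

lemma K_0: "K 0 i = return_pmf i"
  by (rule pmf_eqI) (simp add: pmf_K P_zero indicator_def)

lemma avg_K_0 [simp]: "avg (K 0) u = u"
  by (auto simp: avg_def K_0)

lemma avg_K_add:
  assumes "0 \<le> s" "0 \<le> t" "bounded_fun u"
  shows "avg (K s) (avg (K t) u) = avg (K (s + t)) u"
  using assms by (intro ext) (simp add: avg_avg, simp add: avg_def K_add)

lemma reversible_K: "0 \<le> t \<Longrightarrow> reversible_kernel p (K t)"
  using detailed_balance by (simp add: reversible_kernel_def pmf_K)

lemma q_nonneg: "i \<noteq> j \<Longrightarrow> 0 \<le> q i j"
  using P_deriv[of i j] unfolding has_field_derivative_iff
  by (intro tendsto_lowerbound[where F = "at 0 within {0..}" and f = "\<lambda>t. (P t i j - P 0 i j) / (t - 0)"])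
    (auto simp: eventually_at_filter P_zero P_nonneg at_within_Ici_at_right intro!: always_eventually)

lemma P_diff_quotient_LIMSEQ:
  assumes "\<And>n. 0 < s n" "s \<longlonglongrightarrow> 0"
  shows "(\<lambda>n. (P (s n) i j - P 0 i j) / s n) \<longlonglongrightarrow> q i j"
proof -
  have "((\<lambda>t. (P t i j - P 0 i j) / (t - 0)) \<longlongrightarrow> q i j) (at 0 within {0..})"
    using P_deriv[of i j] by (simp add: has_field_derivative_iff)
  moreover have "filterlim s (at 0 within {0..}) sequentially"
    unfolding filterlim_at using assms by (auto simp: less_imp_le less_imp_neq intro!: always_eventually)
      (metis less_irrefl)
  ultimately have "(\<lambda>n. (P (s n) i j - P 0 i j) / (s n - 0)) \<longlonglongrightarrow> q i j"
    by (rule filterlim_compose)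
  then show ?thesis by simp
qed

text \<open>Fatou for the difference quotients: off the diagonal \<open>P (s n) i j / s n\<close>
  tends to \<open>q i j\<close>, and on the diagonal the increments of \<open>u\<close>
  vanish.\<close>

lemma dirichlet_le_liminf:
  assumes s: "\<And>n. 0 < s n" "s \<longlonglongrightarrow> 0" and u: "bounded_fun u"
  shows "dirichlet q (pmf p) u \<le> liminf (\<lambda>n. ennreal (energy p (K (s n)) u / s n))"
proof -
  let ?h = "\<lambda>n ij. ennreal (pmf p (fst ij) * (P (s n) (fst ij) (snd ij) / s n) * (u (snd ij) - u (fst ij))\<^sup>2 / 2)"
  have lim: "(\<lambda>n. ?h n ij) \<longlonglongrightarrow> ennreal (if fst ij = snd ij then 0 else
       pmf p (fst ij) * q (fst ij) (snd ij) * (u (snd ij) - u (fst ij))\<^sup>2 / 2)" for ij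
  proof (cases "fst ij = snd ij")
    case False
    then show ?thesis
      using P_diff_quotient_LIMSEQ[OF s, of "fst ij" "snd ij"]
      by (simp add: P_zero del: times_divide_eq_right times_divide_eq_left) (intro tendsto_ennrealI tendsto_intros, auto)
  qed simp
  have "energy p (K (s n)) u / s n = inverse (s n) * energy p (K (s n)) u" for n
    by (simp add: divide_inverse mult.commute)
  then have eq: "ennreal (energy p (K (s n)) u / s n) = (\<integral>\<^sup>+ ij. ?h n ij \<partial>count_space UNIV)" for n
    using s(1)[of n] u reversible_K[of "s n"]
    by (simp add: ennreal_mult energy_nonneg energy_nn_integral nn_integral_cmult[symmetric])
      (intro nn_integral_cong, auto simp: ennreal_mult'[symmetric] pmf_K field_simps)
  have "dirichlet q (pmf p) u = (\<integral>\<^sup>+ ij. liminf (\<lambda>n. ?h n ij) \<partial>count_space UNIV)"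
    unfolding dirichlet_def
    using lim_imp_Liminf[OF sequentially_bot lim] by (intro nn_integral_cong) simp
  also have "\<dots> \<le> liminf (\<lambda>n. \<integral>\<^sup>+ ij. ?h n ij \<partial>count_space UNIV)"
    by (rule nn_integral_liminf) simp
  finally show ?thesis by (simp add: eq)
qed

section \<open>Autocovariance and its decay\<close>

definition autocov :: "('a \<Rightarrow> real) \<Rightarrow> real \<Rightarrow> real" where
  "autocov u t = E (\<lambda>i. u i * avg (K t) u i)"

lemma autocov_split:
  assumes "0 \<le> s" "0 \<le> t" "bounded_fun u"
  shows "autocov u (s + t) = E (\<lambda>i. avg (K s) u i * avg (K t) u i)"
  using avg_symmetric[OF reversible_K[OF assms(1)] assms(3), of "avg (K t) u"] assms
  by (simp add: autocov_def avg_K_add)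

lemma autocov_half:
  assumes "0 \<le> t" "bounded_fun u"
  shows "autocov u t = E (\<lambda>i. (avg (K (t/2)) u i)\<^sup>2)"
  using autocov_split[of "t/2" "t/2" u] assms by (simp add: power2_eq_square)

lemma autocov_0: "autocov u 0 = E (\<lambda>i. (u i)\<^sup>2)"
  by (simp add: autocov_def power2_eq_square)

lemma autocov_nonneg: "0 \<le> t \<Longrightarrow> bounded_fun u \<Longrightarrow> 0 \<le> autocov u t"
  by (simp add: autocov_half)

text \<open>Half of the time \<open>r\<close> is moved to each side of the inner product, so that
  the loss over a further time \<open>s\<close> becomes an energy.\<close>

lemma autocov_diff:
  assumes "0 \<le> r" "0 \<le> s" "bounded_fun u"
  shows "autocov u r - autocov u (r + s) = energy p (K s) (avg (K (r/2)) u)"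
proof -
  have "autocov u (r/2 + (s + r/2)) = E (\<lambda>i. avg (K (r/2)) u i * avg (K s) (avg (K (r/2)) u) i)"
    using assms by (subst autocov_split) (simp_all add: avg_K_add)
  moreover have "r/2 + (s + r/2) = r + s" by simp
  ultimately show ?thesis using assms by (simp add: energy_def autocov_half)
qed

lemma autocov_decay:
  assumes gap: "\<And>w. bounded_fun w \<Longrightarrow> E w = 0 \<Longrightarrow> ennreal (c * E (\<lambda>i. (w i)\<^sup>2)) \<le> dirichlet q (pmf p) w"
    and u: "bounded_fun u" "E u = 0" and c: "0 \<le> c" and t: "0 \<le> t"
  shows "autocov u t \<le> exp (- c * t) * E (\<lambda>i. (u i)\<^sup>2)"
proof -
  define s where "s n = inverse (real (Suc n))" for n
  have s: "\<And>n. 0 < s n" "s \<longlonglongrightarrow> 0"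
    unfolding s_def[abs_def] using LIMSEQ_inverse_real_of_nat by auto
  have anti: "autocov u (r + h) \<le> autocov u r" if "0 \<le> r" "0 \<le> h" for r h
    using autocov_diff[OF that u(1)] energy_nonneg[OF reversible_K[OF that(2)], of "avg (K (r/2)) u"] u by simp
  have "eventually (\<lambda>n. autocov u (r + s n) \<le> (1 - c' * s n) * autocov u r) sequentially"
    if r: "0 \<le> r" and c': "c' < c" for r c'
  proof -
    \<comment> \<open>\<open>w\<close> is centered and its second moment is
      \<open>autocov u r\<close>, so the Poincare inequality for \<open>w\<close> controls the drop
      after time \<open>r\<close>.\<close>
    define w where "w = avg (K (r/2)) u"
    have w: "bounded_fun w" "E w = 0" "E (\<lambda>i. (w i)\<^sup>2) = autocov u r"
      using u r by (auto simp: w_def expectation_avg reversible_K autocov_half)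
    have y: "0 \<le> autocov u r" using r u by (intro autocov_nonneg)
    \<comment> \<open>Fatou turns the Poincare inequality into a bound on the quotients for all
      large n once \<open>c\<close> is lowered to \<open>c'\<close>. This needs a strict inequality,
      hence \<open>c'\<close> and \<open>autocov u r\<close> positive; otherwise the left side is at
      most 0 and the energy is nonnegative.\<close>
    have ev: "eventually (\<lambda>n. c' * autocov u r \<le> energy p (K (s n)) w / s n) sequentially"
    proof (cases "c' \<le> 0 \<or> autocov u r = 0")
      case True
      then have "c' * autocov u r \<le> 0" using y by (auto simp: mult_nonpos_nonneg)
      moreover have "0 \<le> energy p (K (s n)) w / s n" for n
        using s(1)[of n] w by (simp add: energy_nonneg reversible_K)
      ultimately show ?thesis by (intro always_eventually) (metis order_trans)
    next
      case False
      then have "ennreal (c' * autocov u r) < ennreal (c * autocov u r)"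
        using c' y by (subst ennreal_less_iff) auto
      also have "\<dots> \<le> dirichlet q (pmf p) w" using gap[OF w(1,2)] w(3) by simp
      also have "\<dots> \<le> liminf (\<lambda>n. ennreal (energy p (K (s n)) w / s n))"
        by (intro dirichlet_le_liminf s w)
      finally have "eventually (\<lambda>n. ennreal (c' * autocov u r) < ennreal (energy p (K (s n)) w / s n)) sequentially"
        by (rule less_LiminfD)
      then show ?thesis
        by eventually_elim (use False y in \<open>auto simp: ennreal_less_iff\<close>)
    qed
    then show ?thesis
    proof eventually_elim
      case (elim n)
      then have "c' * autocov u r * s n \<le> energy p (K (s n)) w" using s(1)[of n] by (simp add: pos_le_divide_eq)
      then show ?case using autocov_diff[OF r less_imp_le[OF s(1)[of n]] u(1)]
        by (simp add: w_def algebra_simps)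
    qed
  qed
  from exponential_decay_from_steps[of "autocov u" s c t, OF _ anti s this t] u
  show ?thesis by (simp add: autocov_nonneg autocov_0)
qed

section \<open>The Poincare inequality and the explicit bound\<close>

lemma L2_normalized_centered_bounded:
  assumes "bounded_fun w" "E w = 0" "E (\<lambda>i. (w i)\<^sup>2) = 1"
  shows "L2_normalized_centered (pmf p) w"
  unfolding L2_normalized_centered_def
proof
  have "esum (\<lambda>i. pmf p i * (w i)\<^sup>2) = (\<integral>\<^sup>+ i. ennreal ((w i)\<^sup>2) \<partial>measure_pmf p)"
    by (rule esum_pmf) simp
  also have "\<dots> = ennreal (E (\<lambda>i. (w i)\<^sup>2))" using assms by (intro nn_integral_eq_integral) auto
  finally show "esum (\<lambda>i. pmf p i * (w i)\<^sup>2) = 1" using assms by simp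
  show "(\<Sum>\<^sub>\<infinity>i. pmf p i * w i) = 0" using assms by (simp add: infsum_pmf)
qed

abbreviation gap :: real where
  "gap \<equiv> spectral_gap q (pmf p)"

lemma gap_nonneg: "0 \<le> gap"
  by (simp add: spectral_gap_def)

lemma poincare_bounded:
  assumes "bounded_fun w" "E w = 0"
  shows "ennreal (gap * E (\<lambda>i. (w i)\<^sup>2)) \<le> dirichlet q (pmf p) w"
proof (cases "E (\<lambda>i. (w i)\<^sup>2) = 0")
  case False
  define v where "v = E (\<lambda>i. (w i)\<^sup>2)"
  have v: "0 < v" using False unfolding v_def by (simp add: less_le)
  define a where "a = 1 / sqrt v"
  have a2: "a\<^sup>2 = 1 / v" using v by (simp add: a_def power_divide)
  have "L2_normalized_centered (pmf p) (\<lambda>i. a * w i)"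
    using assms v by (intro L2_normalized_centered_bounded) (auto simp: power_mult_distrib a2 v_def[symmetric])
  then have "(INF g \<in> {g. L2_normalized_centered (pmf p) g}. dirichlet q (pmf p) g)
      \<le> dirichlet q (pmf p) (\<lambda>i. a * w i)"
    by (intro INF_lower) auto
  \<comment> \<open>If the infimum is \<open>top\<close>, then \<open>enn2real\<close> makes
    \<open>gap\<close> equal to 0, so \<open>ennreal gap\<close> is at most the infimum in either
    case.\<close>
  then have "ennreal gap \<le> ennreal (1 / v) * dirichlet q (pmf p) w"
    unfolding spectral_gap_def dirichlet_scale a2
    by (auto simp: ennreal_enn2real_if)
  then have "ennreal v * ennreal gap \<le> ennreal v * (ennreal (1 / v) * dirichlet q (pmf p) w)"
    by (intro mult_left_mono) auto
  also have "\<dots> = dirichlet q (pmf p) w"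
    using v by (simp add: mult.assoc[symmetric] ennreal_mult'[symmetric])
  finally show ?thesis using v gap_nonneg by (simp add: v_def[symmetric] ennreal_mult'[symmetric] mult.commute)
qed simp

lemma fnorm_bound:
  assumes f: "\<And>i. 0 \<le> f i" and f2: "esum (\<lambda>k. pmf p k * (f k)\<^sup>2) < \<infinity>" and t: "0 \<le> t"
  shows "fnorm f (\<lambda>j. P t i j - pmf p j)
    \<le> ennreal (sqrt (enn2real (esum (\<lambda>k. pmf p k * (f k)\<^sup>2))) * sqrt (1 / pmf p i - 1) * exp (- gap * t))"
proof -
  \<comment> \<open>The density of the point mass at \<open>i\<close> with respect to
    \<open>p\<close>, minus 1. Its second moment is the source of the factor
    \<open>1 / pmf p i - 1\<close>.\<close>
  define v where "v = (\<lambda>j. indicator {i} j / pmf p i - 1)"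
  have ind: "bounded_fun (indicator {i} :: 'a \<Rightarrow> real)" by (rule bounded_funI[of _ 1]) (auto simp: indicator_def)
  have bi: "bounded_fun (\<lambda>j. indicator {i} j / pmf p i :: real)"
    using bounded_fun_mult[OF ind bounded_fun_const[of "1 / pmf p i"]] by simp
  have v: "bounded_fun v" unfolding v_def using bi by simp
  have avg_v: "avg (K t) v j = P t j i / pmf p i - 1" for j
    unfolding avg_def v_def using bi t ind by (simp add: measure_pmf_single pmf_K)
  have p0: "pmf p i \<noteq> 0" using pmf_pos[of i] by simp
  have Ev: "E v = 0" unfolding v_def using bi ind p0 by (simp add: measure_pmf_single)
  have "E (\<lambda>j. (v j)\<^sup>2) = E (\<lambda>j. indicator {i} j * (1 / (pmf p i)\<^sup>2 - 2 / pmf p i) + 1)"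
    unfolding v_def by (intro Bochner_Integration.integral_cong)
      (auto simp: power2_diff power_divide indicator_def)
  also have "\<dots> = pmf p i * (1 / (pmf p i)\<^sup>2 - 2 / pmf p i) + 1"
    using ind by (simp add: measure_pmf_single)
  also have "\<dots> = 1 / pmf p i - 1"
    using p0 by (simp add: power2_eq_square right_diff_distrib)
  finally have Ev2: "E (\<lambda>j. (v j)\<^sup>2) = 1 / pmf p i - 1" .
  \<comment> \<open>The squared norm at time \<open>t\<close> is the autocovariance at time
    \<open>2 * t\<close>; the doubled exponent is undone by the square root in
    Cauchy-Schwarz.\<close>
  have "E (\<lambda>j. (avg (K t) v j)\<^sup>2) = autocov v (2 * t)" using v t by (simp add: autocov_half)
  also have "\<dots> \<le> exp (- gap * (2 * t)) * (1 / pmf p i - 1)"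
    using autocov_decay[OF poincare_bounded v Ev gap_nonneg, of "2 * t"] t by (simp add: Ev2)
  finally have decay: "E (\<lambda>j. (avg (K t) v j)\<^sup>2) \<le> (exp (- gap * t))\<^sup>2 * (1 / pmf p i - 1)"
    by (simp add: exp_double[symmetric] algebra_simps)
  have pi1: "0 \<le> 1 / pmf p i - 1" using pmf_le_1[of p i] pmf_pos[of i] by simp
  define F where "F = enn2real (esum (\<lambda>k. pmf p k * (f k)\<^sup>2))"
  have F: "(\<integral>\<^sup>+ j. (ennreal (f j))\<^sup>2 \<partial>measure_pmf p) = ennreal F"
    using f2 f by (simp add: F_def esum_pmf ennreal_power)
  \<comment> \<open>By detailed balance \<open>avg (K t) v\<close> is the density of row
    \<open>i\<close> of \<open>P t\<close> with respect to \<open>p\<close>, minus 1, which turns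
    the f-norm into an integral against \<open>p\<close>.\<close>
  have "fnorm f (\<lambda>j. P t i j - pmf p j) = (\<integral>\<^sup>+ j. ennreal (f j) * ennreal \<bar>avg (K t) v j\<bar> \<partial>measure_pmf p)"
    unfolding fnorm_def esum_def nn_integral_measure_pmf
  proof (intro nn_integral_cong)
    fix j
    have "pmf p j * avg (K t) v j = P t i j - pmf p j"
      using detailed_balance[OF t, of i j] p0 by (simp add: avg_v field_simps)
    then have "f j * \<bar>P t i j - pmf p j\<bar> = pmf p j * (f j * \<bar>avg (K t) v j\<bar>)"
      by (metis abs_mult abs_of_nonneg mult.left_commute pmf_nonneg)
    then show "ennreal (f j * \<bar>P t i j - pmf p j\<bar>) = ennreal (pmf p j) * (ennreal (f j) * ennreal \<bar>avg (K t) v j\<bar>)"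
      using f by (simp only: ennreal_mult[symmetric] abs_ge_zero pmf_nonneg mult_nonneg_nonneg)
  qed
  then have "(fnorm f (\<lambda>j. P t i j - pmf p j))\<^sup>2
      \<le> ennreal F * (\<integral>\<^sup>+ j. (ennreal \<bar>avg (K t) v j\<bar>)\<^sup>2 \<partial>measure_pmf p)"
    by (simp add: F[symmetric] Cauchy_Schwarz_nn_integral)
  also have "(\<integral>\<^sup>+ j. (ennreal \<bar>avg (K t) v j\<bar>)\<^sup>2 \<partial>measure_pmf p) = ennreal (E (\<lambda>j. (avg (K t) v j)\<^sup>2))"
    using v by (subst nn_integral_eq_integral[symmetric]) (auto simp: ennreal_power)
  also have "ennreal F * ennreal (E (\<lambda>j. (avg (K t) v j)\<^sup>2))
      \<le> ennreal F * ennreal ((exp (- gap * t))\<^sup>2 * (1 / pmf p i - 1))"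
    using decay by (intro mult_left_mono ennreal_leI) auto
  also have "\<dots> = (ennreal (sqrt F * sqrt (1 / pmf p i - 1) * exp (- gap * t)))\<^sup>2"
    using pi1 by (simp add: ennreal_power ennreal_mult'[symmetric] power_mult_distrib mult_ac F_def)
  finally have "(fnorm f (\<lambda>j. P t i j - pmf p j))\<^sup>2
      \<le> (ennreal (sqrt F * sqrt (1 / pmf p i - 1) * exp (- gap * t)))\<^sup>2" .
  then show ?thesis unfolding F_def using pi1 by (intro ennreal_power2_le_imp_le) auto
qed

end

section \<open>The spectral gap dominates every rate\<close>

text \<open>The normalized quantity \<open>z t = y t * exp (\<epsilon> * t) / y 0\<close> is bounded
  and satisfies \<open>z t ^ 2 \<le> z (2 * t)\<close>. A value above 1 would make the values at
  \<open>2 ^ k * t\<close> grow without bound, so the constant \<open>D\<close> improves to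
  \<open>y 0\<close>.\<close>

lemma exponential_rate_from_doubling:
  fixes y :: "real \<Rightarrow> real"
  assumes nonneg: "\<And>t. 0 \<le> t \<Longrightarrow> 0 \<le> y t"
    and double: "\<And>t. 0 \<le> t \<Longrightarrow> (y t)\<^sup>2 \<le> y 0 * y (2 * t)"
    and bound: "\<And>t. 0 \<le> t \<Longrightarrow> y t \<le> D * exp (- \<epsilon> * t)"
    and t: "0 \<le> t"
  shows "y t \<le> exp (- \<epsilon> * t) * y 0"
proof (cases "y 0 = 0")
  case True
  then show ?thesis using double[OF t] by simp
next
  case False
  with nonneg[of 0] have y0: "0 < y 0" by simp
  define z where "z t = y t * exp (\<epsilon> * t) / y 0" for t
  have z0: "0 \<le> z t" if "0 \<le> t" for t using nonneg[OF that] y0 by (simp add: z_def)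
  have z2: "(z t)\<^sup>2 \<le> z (2 * t)" if "0 \<le> t" for t
  proof -
    have "(z t)\<^sup>2 = (y t)\<^sup>2 * exp (\<epsilon> * (2 * t)) / (y 0)\<^sup>2"
      by (simp add: z_def power_mult_distrib power_divide exp_double[symmetric] mult_ac)
    also have "\<dots> \<le> (y 0 * y (2 * t)) * exp (\<epsilon> * (2 * t)) / (y 0)\<^sup>2"
      using double[OF that] by (intro divide_right_mono mult_right_mono) auto
    also have "\<dots> = z (2 * t)" using y0 by (simp add: z_def power2_eq_square)
    finally show ?thesis .
  qed
  have zD: "z t \<le> D / y 0" if "0 \<le> t" for t
  proof -
    have "y t * exp (\<epsilon> * t) \<le> D * exp (- \<epsilon> * t) * exp (\<epsilon> * t)"
      using bound[OF that] by (intro mult_right_mono) auto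
    also have "\<dots> = D" by (simp add: mult.assoc exp_add[symmetric])
    finally show ?thesis unfolding z_def using y0 by (intro divide_right_mono) auto
  qed
  have pow: "z t ^ (2 ^ k) \<le> z (2 ^ k * t)" for k
  proof (induction k)
    case (Suc k)
    have "z t ^ (2 ^ Suc k) = (z t ^ (2 ^ k))\<^sup>2" by (simp add: power_mult[symmetric] mult.commute)
    also have "\<dots> \<le> (z (2 ^ k * t))\<^sup>2" using Suc z0[OF t] by (intro power_mono) auto
    also have "\<dots> \<le> z (2 * (2 ^ k * t))" using t by (intro z2) auto
    finally show ?case by (simp add: mult_ac)
  qed simp
  have "z t \<le> 1"
  proof (rule ccontr)
    assume *: "\<not> z t \<le> 1"
    then obtain n where "D / y 0 < z t ^ n" using real_arch_pow[of "z t" "D / y 0"] by auto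
    also have "\<dots> \<le> z t ^ (2 ^ n)" using * by (intro power_increasing) (auto simp: less_imp_le)
    also have "\<dots> \<le> D / y 0" using order_trans[OF pow zD] t by simp
    finally show False by simp
  qed
  then have "y t * exp (\<epsilon> * t) \<le> y 0" using y0 by (simp add: z_def pos_divide_le_eq)
  then have "exp (- \<epsilon> * t) * (y t * exp (\<epsilon> * t)) \<le> exp (- \<epsilon> * t) * y 0" by (intro mult_left_mono) auto
  also have "exp (- \<epsilon> * t) * (y t * exp (\<epsilon> * t)) = y t" by (simp add: mult.left_commute exp_add[symmetric])
  finally show ?thesis .
qed

context reversible_chain
begin

section \<open>Variance decay from an exponential rate\<close>

lemma autocov_doubling:
  assumes "0 \<le> t" "bounded_fun u"
  shows "(autocov u t)\<^sup>2 \<le> autocov u 0 * autocov u (2 * t)"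
  using expectation_Cauchy_Schwarz[of u "avg (K t) u" p] assms
  by (simp add: autocov_0 autocov_half[of "2 * t"] autocov_def[of u t])

lemma autocov_centered:
  assumes "0 \<le> t" "bounded_fun u"
  shows "autocov (\<lambda>i. u i - E u) t = autocov u t - (E u)\<^sup>2"
proof -
  have avg: "avg (K t) (\<lambda>i. u i - E u) i = avg (K t) u i - E u" for i
    using assms by (simp add: avg_def)
  have "autocov (\<lambda>i. u i - E u) t = E (\<lambda>i. (u i * avg (K t) u i - E u * u i) - (E u * avg (K t) u i - (E u)\<^sup>2))"
    unfolding autocov_def avg by (intro Bochner_Integration.integral_cong) (auto simp: power2_eq_square algebra_simps)
  also have "\<dots> = autocov u t - E u * E u - (E u * E (avg (K t) u) - (E u)\<^sup>2)"
    using assms by (simp add: autocov_def)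
  finally show ?thesis
    using assms by (simp add: expectation_avg reversible_K power2_eq_square)
qed

text \<open>The constants \<open>C i\<close> come with no summability in \<open>i\<close>; finite
  support lets them enter through a finite sum. The doubling argument then replaces the resulting
  constant by the variance.\<close>

lemma variance_decay_finite_support:
  assumes rate: "\<And>i t. 0 \<le> t \<Longrightarrow> fnorm f (\<lambda>j. P t i j - pmf p j) \<le> ennreal (C i * exp (- \<epsilon> * t))"
    and f: "\<And>i. 1 \<le> f i" and C: "\<And>i. 0 \<le> C i"
    and A: "finite A" and u: "bounded_fun u" and uA: "\<And>i. i \<notin> A \<Longrightarrow> u i = 0" and t: "0 \<le> t"
  shows "autocov u t - (E u)\<^sup>2 \<le> exp (- \<epsilon> * t) * (E (\<lambda>i. (u i)\<^sup>2) - (E u)\<^sup>2)"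
proof -
  obtain c where c: "0 < c" "\<And>x. \<bar>u x\<bar> \<le> c" using u by (metis bounded_funE)
  let ?u = "\<lambda>i. u i - E u"
  \<comment> \<open>As \<open>f\<close> is at least 1, the f-norm dominates the l1 distance.\<close>
  have sum_C: "(\<Sum>j\<in>A. \<bar>P t i j - pmf p j\<bar>) \<le> C i * exp (- \<epsilon> * t)" if t: "0 \<le> t" for i t
  proof -
    have "ennreal (\<Sum>j\<in>A. \<bar>P t i j - pmf p j\<bar>) \<le> esum (\<lambda>j. \<bar>P t i j - pmf p j\<bar>)"
      by (intro sum_le_esum A) simp
    also have "\<dots> \<le> fnorm f (\<lambda>j. P t i j - pmf p j)"
      unfolding fnorm_def esum_def using f
      by (intro nn_integral_mono ennreal_leI) (simp add: mult_le_cancel_right1)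
    also note rate[OF t]
    finally show ?thesis using C[of i] by (simp add: ennreal_le_iff)
  qed
  have pt: "\<bar>avg (K t) u i - E u\<bar> \<le> c * (C i * exp (- \<epsilon> * t))" if t: "0 \<le> t" for i t
  proof -
    have "avg (K t) u i - E u = (\<Sum>j\<in>A. (P t i j - pmf p j) * u j)"
      unfolding avg_def using A uA t
      by (subst (1 2) integral_measure_pmf[of A]) (auto simp: pmf_K sum_subtractf algebra_simps)
    also have "\<bar>\<dots>\<bar> \<le> (\<Sum>j\<in>A. \<bar>(P t i j - pmf p j) * u j\<bar>)" by (rule sum_abs)
    also have "\<dots> \<le> (\<Sum>j\<in>A. c * \<bar>P t i j - pmf p j\<bar>)"
      using c by (intro sum_mono) (simp add: abs_mult mult.commute mult_right_mono)
    also have "\<dots> \<le> c * (C i * exp (- \<epsilon> * t))"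
      using sum_C[OF t] c by (simp add: sum_distrib_left[symmetric])
    finally show ?thesis .
  qed
  have "autocov ?u t \<le> (\<Sum>i\<in>A. c * (c * C i)) * exp (- \<epsilon> * t)" if t: "0 \<le> t" for t
  proof -
    have "autocov ?u t = E (\<lambda>i. u i * (avg (K t) u i - E u))"
      using t u by (simp add: autocov_centered autocov_def[of u] right_diff_distrib power2_eq_square)
    also have "\<dots> = (\<Sum>i\<in>A. pmf p i * (u i * (avg (K t) u i - E u)))"
      using A uA by (subst integral_measure_pmf[of A]) auto
    also have "\<dots> \<le> (\<Sum>i\<in>A. c * (c * C i) * exp (- \<epsilon> * t))"
    proof (intro sum_mono)
      fix i
      have "pmf p i * (u i * (avg (K t) u i - E u)) \<le> \<bar>pmf p i\<bar> * (\<bar>u i\<bar> * \<bar>avg (K t) u i - E u\<bar>)"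
        by (metis abs_ge_self abs_mult)
      also have "\<dots> \<le> 1 * (c * (c * (C i * exp (- \<epsilon> * t))))"
        using c pt[OF t, of i] by (intro mult_mono) (auto simp: pmf_le_1)
      finally show "pmf p i * (u i * (avg (K t) u i - E u)) \<le> c * (c * C i) * exp (- \<epsilon> * t)" by (simp add: mult_ac)
    qed
    finally show ?thesis by (simp add: sum_distrib_right)
  qed
  then have "autocov ?u t \<le> exp (- \<epsilon> * t) * autocov ?u 0"
    using u t autocov_doubling[of _ ?u] by (intro exponential_rate_from_doubling) (auto simp: autocov_nonneg)
  then show ?thesis
    using autocov_centered[OF t u] autocov_centered[OF order_refl u] by (simp add: autocov_0)
qed

text \<open>Restriction to the sets \<open>initial n\<close> and dominated convergence, under
  \<open>p\<close> and under the joint law, remove the finite support. This works because the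
  constant is the variance itself, which converges along with the functions.\<close>

lemma variance_decay:
  assumes rate: "\<And>i t. 0 \<le> t \<Longrightarrow> fnorm f (\<lambda>j. P t i j - pmf p j) \<le> ennreal (C i * exp (- \<epsilon> * t))"
    and f: "\<And>i. 1 \<le> f i" and C: "\<And>i. 0 \<le> C i"
    and u: "bounded_fun u" and t: "0 \<le> t"
  shows "autocov u t - (E u)\<^sup>2 \<le> exp (- \<epsilon> * t) * (E (\<lambda>i. (u i)\<^sup>2) - (E u)\<^sup>2)"
proof -
  obtain c where c: "0 < c" "\<And>x. \<bar>u x\<bar> \<le> c" using u by (metis bounded_funE)
  define w where "w n i = (if i \<in> initial n then u i else 0)" for n i
  have wb: "\<bar>w n i\<bar> \<le> c" for n i using c by (auto simp: w_def)
  then have bw: "bounded_fun (w n)" for n by (rule bounded_funI)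
  have lim: "(\<lambda>n. w n i) \<longlonglongrightarrow> u i" for i
    by (rule tendsto_eventually, rule eventually_mono[OF eventually_initial[of i]]) (simp add: w_def)
  have 1: "(\<lambda>n. E (w n)) \<longlonglongrightarrow> E u"
    using wb lim by (intro integral_dominated_convergence[where w = "\<lambda>_. c"]) auto
  have 2: "(\<lambda>n. E (\<lambda>i. (w n i)\<^sup>2)) \<longlonglongrightarrow> E (\<lambda>i. (u i)\<^sup>2)"
    using power_mono[OF wb abs_ge_zero, where n = 2] lim
    by (intro integral_dominated_convergence[where w = "\<lambda>_. c\<^sup>2"]) (auto intro!: tendsto_intros)
  have eq: "autocov v t = measure_pmf.expectation (transitions p (K t)) (\<lambda>ij. v (fst ij) * v (snd ij))"
    if "bounded_fun v" for v using that by (simp add: autocov_def expectation_mult_avg)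
  have 3: "(\<lambda>n. autocov (w n) t) \<longlonglongrightarrow> autocov u t"
    unfolding eq[OF u] eq[OF bw]
  proof (intro integral_dominated_convergence[where w = "\<lambda>_. c * c"])
    show "AE ij in measure_pmf (transitions p (K t)). norm (w n (fst ij) * w n (snd ij)) \<le> c * c" for n
      using wb c by (auto simp: abs_mult intro!: mult_mono AE_I2)
  qed (auto intro!: tendsto_intros lim)
  show ?thesis
  proof (rule LIMSEQ_le)
    show "(\<lambda>n. autocov (w n) t - (E (w n))\<^sup>2) \<longlonglongrightarrow> autocov u t - (E u)\<^sup>2"
      by (intro tendsto_intros 1 3)
    show "(\<lambda>n. exp (- \<epsilon> * t) * (E (\<lambda>i. (w n i)\<^sup>2) - (E (w n))\<^sup>2)) \<longlonglongrightarrow> exp (- \<epsilon> * t) * (E (\<lambda>i. (u i)\<^sup>2) - (E u)\<^sup>2)"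
      by (intro tendsto_intros 1 2)
    have "autocov (w n) t - (E (w n))\<^sup>2 \<le> exp (- \<epsilon> * t) * (E (\<lambda>i. (w n i)\<^sup>2) - (E (w n))\<^sup>2)" for n
      using variance_decay_finite_support[OF rate f C finite_initial[of n] bw[of n] _ t] by (simp add: w_def)
    then show "\<exists>N. \<forall>n\<ge>N. autocov (w n) t - (E (w n))\<^sup>2 \<le> exp (- \<epsilon> * t) * (E (\<lambda>i. (w n i)\<^sup>2) - (E (w n))\<^sup>2)"
      by blast
  qed
qed

section \<open>Killed and reflected kernels on a finite set\<close>

text \<open>Jumps out of \<open>A\<close> are suppressed, so the kernel dominates the killed one and keeps detailed balance.\<close>
definition reflected :: "'a set \<Rightarrow> real \<Rightarrow> 'a \<Rightarrow> 'a pmf" where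
  "reflected A s i = (if i \<in> A then map_pmf (\<lambda>j. if j \<in> A then j else i) (K s i) else return_pmf i)"

lemma pmf_reflected_offdiag:
  assumes "i \<noteq> j" "0 \<le> s"
  shows "pmf (reflected A s i) j = (if i \<in> A \<and> j \<in> A then P s i j else 0)"
proof (cases "i \<in> A")
  case True
  have "(\<lambda>k. if k \<in> A then k else i) -` {j} = (if j \<in> A then {j} else {})"
    using True assms by (auto split: if_splits)
  then show ?thesis using True assms by (simp add: reflected_def pmf_map measure_pmf_single pmf_K)
qed (use assms in \<open>simp add: reflected_def\<close>)

lemma pmf_reflected_ge:
  assumes "i \<in> A" "j \<in> A" "0 \<le> s"
  shows "P s i j \<le> pmf (reflected A s i) j"
proof -
  have "P s i j = measure_pmf.prob (K s i) {j}" using assms by (simp add: measure_pmf_single pmf_K)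
  also have "\<dots> \<le> measure_pmf.prob (K s i) ((\<lambda>k. if k \<in> A then k else i) -` {j})"
    using assms by (intro measure_pmf.finite_measure_mono) auto
  finally show ?thesis using assms by (simp add: reflected_def pmf_map)
qed

lemma reversible_reflected:
  assumes "0 \<le> s" shows "reversible_kernel p (reflected A s)"
  unfolding reversible_kernel_def
proof (intro allI)
  fix i j
  show "pmf p i * pmf (reflected A s i) j = pmf p j * pmf (reflected A s j) i"
    using assms detailed_balance[of s i j]
    by (cases "i = j") (simp_all add: pmf_reflected_offdiag)
qed

text \<open>The mass of the suppressed jumps sits on the diagonal, where increments of
  \<open>u\<close> vanish, so only transitions inside \<open>A\<close> contribute.\<close>

lemma energy_reflected:
  assumes "finite A" "0 \<le> s" "bounded_fun u"
  shows "energy p (reflected A s) u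
    = (\<Sum>ij\<in>A \<times> A. pmf p (fst ij) * P s (fst ij) (snd ij) * (u (snd ij) - u (fst ij))\<^sup>2 / 2)"
proof -
  let ?h = "\<lambda>K ij. pmf p (fst ij) * K (fst ij) (snd ij) * (u (snd ij) - u (fst ij))\<^sup>2 / 2 :: real"
  let ?R = "\<lambda>i. pmf (reflected A s i)"
  have off: "?h ?R ij = (if ij \<in> A \<times> A then ?h (P s) ij else 0)" for ij
    using assms by (cases ij, cases "fst ij = snd ij") (auto simp: pmf_reflected_offdiag)
  have "ennreal (energy p (reflected A s) u) = esum (?h ?R)"
    using assms by (simp add: energy_nn_integral reversible_reflected esum_def)
  also have "\<dots> = ennreal (\<Sum>ij\<in>A \<times> A. ?h ?R ij)"
  proof (rule esum_finite_support)
    show "0 \<le> ?h ?R ij" for ij by simp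
  qed (use assms(1) off in auto)
  also have "(\<Sum>ij\<in>A \<times> A. ?h ?R ij) = (\<Sum>ij\<in>A \<times> A. ?h (P s) ij)"
    by (intro sum.cong) (auto simp: off)
  finally have "ennreal (energy p (reflected A s) u) = ennreal (\<Sum>ij\<in>A \<times> A. ?h (P s) ij)" .
  moreover have "0 \<le> (\<Sum>ij\<in>A \<times> A. ?h (P s) ij)"
    using assms by (intro sum_nonneg divide_nonneg_pos mult_nonneg_nonneg P_nonneg) auto
  ultimately show ?thesis using assms by (simp add: energy_nonneg reversible_reflected)
qed

text \<open>Entrywise domination on \<open>A\<close> is preserved by products, and admitting all
  intermediate states only increases the right side.\<close>

lemma taboo_le_reflected:
  assumes A: "finite A" and s: "0 \<le> s"
  shows "taboo P A (replicate (2 ^ n) s) i j \<le> pmf (doubling (reflected A s) n i) j"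
proof (induction n arbitrary: i j)
  case 0
  have "(\<Sum>k\<in>A. P s i k * (if k = j \<and> k \<in> A then 1 else 0)) = (\<Sum>k\<in>A. if k = j then P s i j else 0)"
    by (intro sum.cong) auto
  then show ?case using pmf_reflected_ge[of i A j s] A s by auto
next
  case (Suc n)
  let ?R = "doubling (reflected A s) n"
  have "replicate (2 ^ Suc n) s = replicate (2 ^ n) s @ replicate (2 ^ n) s"
    by (simp add: replicate_add[symmetric])
  then have "taboo P A (replicate (2 ^ Suc n) s) i j
      = (\<Sum>k\<in>A. taboo P A (replicate (2 ^ n) s) i k * taboo P A (replicate (2 ^ n) s) k j)"
    by (simp only: taboo_append[OF A])
  also have "\<dots> \<le> (\<Sum>k\<in>A. pmf (?R i) k * pmf (?R k) j)"
    using s by (intro sum_mono mult_mono Suc taboo_nonneg) auto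
  also have "\<dots> \<le> pmf (doubling (reflected A s) (Suc n) i) j"
  proof -
    have "ennreal (\<Sum>k\<in>A. pmf (?R i) k * pmf (?R k) j) \<le> esum (\<lambda>k. pmf (?R i) k * pmf (?R k) j)"
      by (intro sum_le_esum A) simp
    also have "\<dots> = ennreal (pmf (doubling (reflected A s) (Suc n) i) j)"
      by (simp add: ennreal_pmf_bind esum_pmf)
    finally show ?thesis by simp
  qed
  finally show ?case .
qed

text \<open>The killed kernels increase to \<open>minimal P\<close>, which is \<open>P\<close>; as
  \<open>P\<close> is honest, monotone convergence makes the surviving mass tend to 1 from every
  state. Dominated convergence then integrates over the start.\<close>

lemma escape_LIMSEQ:
  assumes t: "0 \<le> t"
  shows "(\<lambda>n. E (\<lambda>i. 1 - (\<Sum>j\<in>initial n. killed P (initial n) t i j))) \<longlonglongrightarrow> 0"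
proof -
  let ?S = "\<lambda>n i. \<Sum>j\<in>initial n. killed P (initial n) t i j"
  have eq: "ennreal (?S n i) = (\<integral>\<^sup>+ j. ennreal (killed P (initial n) t i j) \<partial>count_space UNIV)" for n i
    using esum_finite_support[of "initial n" "killed P (initial n) t i"] t
    by (simp add: killed_nonneg killed_outside2 esum_def)
  have lim: "(\<lambda>n. ?S n i) \<longlonglongrightarrow> 1" for i
  proof -
    have "(\<lambda>n. ennreal (?S n i)) \<longlonglongrightarrow> (\<integral>\<^sup>+ j. ennreal (P t i j) \<partial>count_space UNIV)"
      unfolding eq using t minimal_LIMSEQ[OF t, of i]
      by (intro nn_integral_LIMSEQ incseq_SucI le_funI ennreal_leI killed_mono tendsto_ennrealI)
        (auto intro!: initial_mono simp: minimal_eq)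
    also have "(\<integral>\<^sup>+ j. ennreal (P t i j) \<partial>count_space UNIV) = ennreal 1"
      using honest[OF t, of i] by (simp add: esum_def)
    finally show ?thesis
      using t by (subst (asm) tendsto_ennreal_iff) (auto intro!: always_eventually sum_nonneg killed_nonneg)
  qed
  have S1: "?S n i \<le> 1" for n i
  proof -
    have "ennreal (?S n i) \<le> esum (P t i)"
      unfolding eq esum_def using t by (intro nn_integral_mono ennreal_leI killed_le) auto
    then show ?thesis using honest[OF t, of i] by simp
  qed
  have S0: "0 \<le> ?S n i" for n i using t by (intro sum_nonneg killed_nonneg)
  have lim0: "(\<lambda>n. 1 - ?S n i) \<longlonglongrightarrow> 0" for i
    using tendsto_diff[OF tendsto_const lim[of i], of 1] by simp
  have "(\<lambda>n. E (\<lambda>i. 1 - ?S n i)) \<longlonglongrightarrow> E (\<lambda>i. 0)"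
  proof (intro integral_dominated_convergence[where w = "\<lambda>_. 1"])
    show "AE i in measure_pmf p. norm (1 - ?S n i) \<le> 1" for n
      using S0[of n] S1[of n] by (intro AE_I2) auto
  qed (auto intro!: lim0)
  then show ?thesis by simp
qed

text \<open>The killed kernel is a common part of \<open>K t\<close> and of the
  \<open>2 ^ n\<close>-step reflected kernel, so their averages of \<open>u\<close> differ by at
  most a multiple of the escaped mass. The reflected energy is at most \<open>2 ^ n\<close> times
  its one-step value, and letting n grow brings in the rates inside \<open>A\<close>.\<close>

lemma energy_le_truncated:
  assumes t: "0 < t" and c: "\<And>x. \<bar>u x\<bar> \<le> c" and A: "finite A"
  shows "energy p (K t) u \<le> t * (\<Sum>ij\<in>A \<times> A. if fst ij = snd ij then 0 else
      pmf p (fst ij) * q (fst ij) (snd ij) * (u (snd ij) - u (fst ij))\<^sup>2 / 2)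
    + 2 * c\<^sup>2 * E (\<lambda>i. 1 - (\<Sum>j\<in>A. killed P A t i j))"
proof -
  have u: "bounded_fun u" using c by (rule bounded_funI)
  have c0: "0 \<le> c" using c[of undefined] by linarith
  \<comment> \<open>Dyadic steps, so that \<open>2 ^ n\<close> steps of length \<open>s n\<close>
    make up the time \<open>t\<close>, and \<open>2 ^ n\<close> equals
    \<open>t / s n\<close>.\<close>
  define s where "s n = t / 2 ^ n" for n :: nat
  have s: "\<And>n. 0 < s n" "s \<longlonglongrightarrow> 0"
    using t LIMSEQ_divide_realpow_zero[of 2 t] by (auto simp: s_def[abs_def])
  let ?S = "\<lambda>i. \<Sum>j\<in>A. killed P A t i j"
  let ?R = "\<lambda>n. doubling (reflected A (s n)) n"
  have bS: "bounded_fun ?S"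
  proof (rule bounded_funI[of _ "real (card A)"])
    fix i
    have "0 \<le> ?S i" using t by (intro sum_nonneg killed_nonneg) auto
    moreover have "?S i \<le> (\<Sum>j\<in>A. 1)"
      using t A by (intro sum_mono order_trans[OF killed_le P_le_1]) auto
    ultimately show "\<bar>?S i\<bar> \<le> real (card A)" by simp
  qed
  have diff: "\<bar>avg (K t) u i - avg (?R n) u i\<bar> \<le> 2 * c * (1 - ?S i)" for n i
    unfolding avg_def
  proof (rule expectation_common_part[OF A])
    fix j
    show "0 \<le> killed P A t i j" "killed P A t i j \<le> pmf (K t i) j"
      using t A by (auto simp: killed_nonneg killed_le pmf_K)
    have "replicate (2 ^ n) (s n) \<in> partitions t"
      using t by (auto simp: partitions_def s_def sum_list_replicate)
    then show "killed P A t i j \<le> pmf (?R n i) j"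
      using taboo_le_reflected[OF A, of "s n" n i j] s(1)[of n] killed_lower[of _ t A i j] by fastforce
  qed (rule c)
  \<comment> \<open>Subtracting \<open>P 0\<close> forms a difference quotient without changing the
    sum: \<open>P 0\<close> vanishes off the diagonal, and the diagonal terms are 0.\<close>
  have bound: "energy p (K t) u \<le> t * (\<Sum>ij\<in>A \<times> A. pmf p (fst ij) *
      ((P (s n) (fst ij) (snd ij) - P 0 (fst ij) (snd ij)) / s n) * (u (snd ij) - u (fst ij))\<^sup>2 / 2)
      + 2 * c\<^sup>2 * E (\<lambda>i. 1 - ?S i)" for n
  proof -
    have "E (\<lambda>i. u i * avg (?R n) u i) - E (\<lambda>i. u i * avg (K t) u i)
        = E (\<lambda>i. u i * (avg (?R n) u i - avg (K t) u i))"
      using u by (simp add: right_diff_distrib)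
    also have "\<dots> \<le> E (\<lambda>i. c * (2 * c * (1 - ?S i)))"
    proof (intro integral_mono integrable_bounded_pmf)
      fix i
      have "u i * (avg (?R n) u i - avg (K t) u i) \<le> \<bar>u i\<bar> * \<bar>avg (K t) u i - avg (?R n) u i\<bar>"
        by (metis abs_ge_self abs_minus_commute abs_mult)
      also have "\<dots> \<le> c * (2 * c * (1 - ?S i))" using c diff c0 by (intro mult_mono) auto
      finally show "u i * (avg (?R n) u i - avg (K t) u i) \<le> c * (2 * c * (1 - ?S i))" .
    qed (use u bS in auto)
    also have "\<dots> = 2 * c\<^sup>2 * E (\<lambda>i. 1 - ?S i)" by (simp add: power2_eq_square)
    finally have "energy p (K t) u \<le> energy p (?R n) u + 2 * c\<^sup>2 * E (\<lambda>i. 1 - ?S i)"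
      by (simp add: energy_def)
    also have "energy p (?R n) u \<le> 2 ^ n * energy p (reflected A (s n)) u"
      using s(1)[of n] u by (intro energy_doubling_le reversible_reflected) auto
    also have "2 ^ n * energy p (reflected A (s n)) u = t * (\<Sum>ij\<in>A \<times> A. pmf p (fst ij) *
      ((P (s n) (fst ij) (snd ij) - P 0 (fst ij) (snd ij)) / s n) * (u (snd ij) - u (fst ij))\<^sup>2 / 2)"
      unfolding energy_reflected[OF A less_imp_le[OF s(1)] u] sum_distrib_left
      using t by (intro sum.cong refl) (auto simp: P_zero s_def field_simps)
    finally show ?thesis by simp
  qed
  have "(\<lambda>n. t * (\<Sum>ij\<in>A \<times> A. pmf p (fst ij) *
      ((P (s n) (fst ij) (snd ij) - P 0 (fst ij) (snd ij)) / s n) * (u (snd ij) - u (fst ij))\<^sup>2 / 2)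
      + 2 * c\<^sup>2 * E (\<lambda>i. 1 - ?S i))
    \<longlonglongrightarrow> t * (\<Sum>ij\<in>A \<times> A. pmf p (fst ij) * q (fst ij) (snd ij) * (u (snd ij) - u (fst ij))\<^sup>2 / 2)
      + 2 * c\<^sup>2 * E (\<lambda>i. 1 - ?S i)"
    by (intro tendsto_intros P_diff_quotient_LIMSEQ s) auto
  from LIMSEQ_le_const[OF this] bound
  have "energy p (K t) u \<le> t * (\<Sum>ij\<in>A \<times> A. pmf p (fst ij) * q (fst ij) (snd ij) * (u (snd ij) - u (fst ij))\<^sup>2 / 2)
      + 2 * c\<^sup>2 * E (\<lambda>i. 1 - ?S i)" by blast
  also have "(\<Sum>ij\<in>A \<times> A. pmf p (fst ij) * q (fst ij) (snd ij) * (u (snd ij) - u (fst ij))\<^sup>2 / 2)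
      = (\<Sum>ij\<in>A \<times> A. if fst ij = snd ij then 0 else
        pmf p (fst ij) * q (fst ij) (snd ij) * (u (snd ij) - u (fst ij))\<^sup>2 / 2)"
    by (intro sum.cong) auto
  finally show ?thesis .
qed

text \<open>The truncated sums stay below the full form, while the escaped mass tends to 0 along
  \<open>initial n\<close>.\<close>

lemma energy_le_dirichlet:
  assumes t: "0 < t" and u: "bounded_fun u" and d: "dirichlet q (pmf p) u = ennreal d" "0 \<le> d"
  shows "energy p (K t) u \<le> t * d"
proof -
  obtain c where c: "\<And>x. \<bar>u x\<bar> \<le> c" using u by (metis bounded_funE)
  let ?e = "\<lambda>n. E (\<lambda>i. 1 - (\<Sum>j\<in>initial n. killed P (initial n) t i j))"
  have "energy p (K t) u \<le> t * d + 2 * c\<^sup>2 * ?e n" for n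
  proof -
    let ?h = "\<lambda>ij. if fst ij = snd ij then 0 else
      pmf p (fst ij) * q (fst ij) (snd ij) * (u (snd ij) - u (fst ij))\<^sup>2 / 2"
    have "ennreal (\<Sum>ij\<in>initial n \<times> initial n. ?h ij) \<le> dirichlet q (pmf p) u"
      unfolding dirichlet_def esum_def[symmetric] by (intro sum_le_esum) (auto simp: q_nonneg)
    then have "(\<Sum>ij\<in>initial n \<times> initial n. ?h ij) \<le> d" using d by simp
    then have "t * (\<Sum>ij\<in>initial n \<times> initial n. ?h ij) \<le> t * d" using t by simp
    with energy_le_truncated[of t u c "initial n", OF t c finite_initial] show ?thesis by linarith
  qed
  moreover have "(\<lambda>n. t * d + 2 * c\<^sup>2 * ?e n) \<longlonglongrightarrow> t * d + 2 * c\<^sup>2 * 0"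
    using t by (intro tendsto_intros escape_LIMSEQ) auto
  ultimately show ?thesis using LIMSEQ_le_const[of _ "t * d + 2 * c\<^sup>2 * 0"] by auto
qed

text \<open>Variance decay against the energy bound gives
  \<open>1 - exp (- \<epsilon> * t) \<le> t * d\<close> for every positive \<open>t\<close>;
  comparing slopes at 0 yields the claim.\<close>

lemma rate_le_dirichlet:
  assumes rate: "\<And>i t. 0 \<le> t \<Longrightarrow> fnorm f (\<lambda>j. P t i j - pmf p j) \<le> ennreal (C i * exp (- \<epsilon> * t))"
    and f: "\<And>i. 1 \<le> f i" and C: "\<And>i. 0 \<le> C i"
    and g: "L2_normalized_centered (pmf p) g"
  shows "ennreal \<epsilon> \<le> dirichlet q (pmf p) g"
proof (cases "dirichlet q (pmf p) g = top")
  case False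
  then obtain d where d: "0 \<le> d" "dirichlet q (pmf p) g = ennreal d"
    by (cases "dirichlet q (pmf p) g") auto
  have nn: "(\<integral>\<^sup>+ i. ennreal ((g i)\<^sup>2) \<partial>measure_pmf p) = 1"
    using g by (simp add: L2_normalized_centered_def esum_pmf)
  have int2: "integrable (measure_pmf p) (\<lambda>i. (g i)\<^sup>2)"
    by (rule integrableI_bounded) (simp_all add: nn)
  have E2: "E (\<lambda>i. (g i)\<^sup>2) = 1"
    using nn nn_integral_eq_integral[OF int2] by simp
  have int: "integrable (measure_pmf p) g"
    by (rule measure_pmf.square_integrable_imp_integrable[OF _ int2]) simp
  have E1: "E g = 0" using g infsum_pmf[OF int] by (simp add: L2_normalized_centered_def)
  \<comment> \<open>Truncation at level \<open>n\<close>, because the decay and energy bounds are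
    available for bounded functions.\<close>
  define w where "w n i = max (- real n) (min (real n) (g i))" for n i
  have wg: "\<bar>w n i\<bar> \<le> \<bar>g i\<bar>" for n i by (auto simp: w_def)
  have bw: "bounded_fun (w n)" for n by (rule bounded_funI[of _ "real n"]) (auto simp: w_def)
  have lim: "(\<lambda>n. w n i) \<longlonglongrightarrow> g i" for i
  proof (rule tendsto_eventually)
    have "eventually (\<lambda>n. \<bar>g i\<bar> \<le> real n) sequentially"
      by (meson eventually_sequentiallyI nat_ceiling_le_eq)
    then show "eventually (\<lambda>n. w n i = g i) sequentially"
      by eventually_elim (auto simp: w_def)
  qed
  have lim1: "(\<lambda>n. E (w n)) \<longlonglongrightarrow> 0"
    unfolding E1[symmetric] using wg lim int
    by (intro integral_dominated_convergence[where w = "\<lambda>i. \<bar>g i\<bar>"]) auto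
  have lim2: "(\<lambda>n. E (\<lambda>i. (w n i)\<^sup>2)) \<longlonglongrightarrow> 1"
    unfolding E2[symmetric] using power_mono[OF wg abs_ge_zero, where n = 2] lim int2
    by (intro integral_dominated_convergence[where w = "\<lambda>i. (g i)\<^sup>2"]) (auto intro!: tendsto_intros)
  \<comment> \<open>Truncation is a contraction of the real line, so it cannot increase the
    form.\<close>
  have dw: "dirichlet q (pmf p) (w n) \<le> ennreal d" for n
  proof -
    have "\<bar>w n j - w n i\<bar> \<le> \<bar>g j - g i\<bar>" for i j by (auto simp: w_def)
    then have "(w n j - w n i)\<^sup>2 \<le> (g j - g i)\<^sup>2" for i j by (simp add: abs_le_square_iff)
    then show ?thesis unfolding d(2)[symmetric] dirichlet_def
      by (intro nn_integral_mono ennreal_leI) (auto intro!: divide_right_mono mult_left_mono simp: q_nonneg)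
  qed
  have le: "1 - exp (- \<epsilon> * t) \<le> t * d" if t: "0 < t" for t
  proof -
    have "E (\<lambda>i. (w n i)\<^sup>2) - (E (w n))\<^sup>2 - exp (- \<epsilon> * t) * (E (\<lambda>i. (w n i)\<^sup>2) - (E (w n))\<^sup>2) \<le> t * d" for n
    proof -
      obtain d' where d': "0 \<le> d'" "dirichlet q (pmf p) (w n) = ennreal d'"
        using dw[of n] by (cases "dirichlet q (pmf p) (w n)") (auto simp: top_unique)
      then have "d' \<le> d" using dw[of n] d by simp
      then have "t * d' \<le> t * d" using t by simp
      moreover have "energy p (K t) (w n) \<le> t * d'" by (rule energy_le_dirichlet[OF t bw d'(2,1)])
      moreover have "energy p (K t) (w n) = E (\<lambda>i. (w n i)\<^sup>2) - autocov (w n) t"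
        by (simp add: energy_def autocov_def)
      ultimately show ?thesis using variance_decay[OF rate f C bw[of n], of t] t by linarith
    qed
    moreover have "(\<lambda>n. E (\<lambda>i. (w n i)\<^sup>2) - (E (w n))\<^sup>2 - exp (- \<epsilon> * t) * (E (\<lambda>i. (w n i)\<^sup>2) - (E (w n))\<^sup>2))
        \<longlonglongrightarrow> 1 - 0\<^sup>2 - exp (- \<epsilon> * t) * (1 - 0\<^sup>2)"
      by (intro tendsto_intros lim1 lim2)
    ultimately show ?thesis using LIMSEQ_le_const2[of _ "1 - 0\<^sup>2 - exp (- \<epsilon> * t) * (1 - 0\<^sup>2)"] by auto
  qed
  have "((\<lambda>t. exp (- \<epsilon> * t)) has_real_derivative - \<epsilon>) (at_right 0)"
    by (auto intro!: derivative_eq_intros)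
  then have "((\<lambda>t. (exp (- \<epsilon> * t) - 1) / t) \<longlongrightarrow> - \<epsilon>) (at_right 0)"
    by (simp add: has_field_derivative_iff)
  then have "- d \<le> - \<epsilon>"
  proof (rule tendsto_lowerbound)
    show "eventually (\<lambda>t. - d \<le> (exp (- \<epsilon> * t) - 1) / t) (at_right 0)"
      using le by (auto simp: eventually_at_filter pos_le_divide_eq mult.commute intro!: always_eventually)
        (smt (verit))
  qed simp
  then show ?thesis using d by (simp add: ennreal_leI)
qed simp

text \<open>Keeps the infimum defining the gap away from \<open>top\<close>, which
  \<open>enn2real\<close> would send to 0. The indicator of \<open>i\<close> works after
  normalization, since its energy quotient tends to \<open>- pmf p i * q i i\<close>; the second
  state makes its variance positive.\<close>

lemma dirichlet_test_function:
  assumes "i \<noteq> (j :: 'a)"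
  shows "\<exists>g. L2_normalized_centered (pmf p) g \<and> dirichlet q (pmf p) g < top"
proof -
  define s where "s n = inverse (real (Suc n))" for n
  have s: "\<And>n. 0 < s n" "s \<longlonglongrightarrow> 0"
    unfolding s_def[abs_def] using LIMSEQ_inverse_real_of_nat by auto
  let ?d = "indicator {i} :: 'a \<Rightarrow> real"
  have bd: "bounded_fun ?d" by (rule bounded_funI[of _ 1]) (auto simp: indicator_def)
  have en: "energy p (K (s n)) ?d / s n = - pmf p i * ((P (s n) i i - P 0 i i) / s n)" for n
  proof -
    have "avg (K (s n)) ?d k = P (s n) k i" for k
      using s(1)[of n] by (simp add: avg_def measure_pmf_single pmf_K)
    moreover have "E (\<lambda>k. ?d k * P (s n) k i) = pmf p i * P (s n) i i"
      by (subst integral_measure_pmf[of "{i}"]) (auto simp: indicator_def split: if_splits)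
    moreover have "E (\<lambda>k. (?d k)\<^sup>2) = pmf p i"
      by (subst integral_measure_pmf[of "{i}"]) (auto simp: indicator_def split: if_splits)
    ultimately show ?thesis by (simp add: energy_def P_zero field_simps)
  qed
  have "(\<lambda>n. ennreal (energy p (K (s n)) ?d / s n)) \<longlonglongrightarrow> ennreal (- pmf p i * q i i)"
    unfolding en by (intro tendsto_ennrealI tendsto_mult tendsto_const P_diff_quotient_LIMSEQ s)
  from lim_imp_Liminf[OF sequentially_bot this] dirichlet_le_liminf[OF s bd]
  have fin: "dirichlet q (pmf p) ?d < top" by (simp add: le_less_trans)
  have "pmf p i < 1"
  proof -
    have "pmf p i + pmf p j = measure_pmf.prob p {i, j}"
      using assms by (simp add: measure_measure_pmf_finite)
    also have "\<dots> \<le> 1" by simp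
    finally show ?thesis using pmf_pos[of j] by simp
  qed
  then have v: "0 < pmf p i * (1 - pmf p i)" using pmf_pos by simp
  define a where "a = 1 / sqrt (pmf p i * (1 - pmf p i))"
  have a2: "a\<^sup>2 * (pmf p i * (1 - pmf p i)) = 1"
    unfolding a_def power_divide real_sqrt_pow2[OF less_imp_le[OF v]] using v
    by (metis less_irrefl nonzero_divide_eq_eq power_one)
  let ?g = "\<lambda>k. a * (?d k - pmf p i)"
  have "E (\<lambda>k. (?d k - pmf p i)\<^sup>2) = E (\<lambda>k. ?d k * (1 - 2 * pmf p i) + (pmf p i)\<^sup>2)"
    by (intro Bochner_Integration.integral_cong) (auto simp: indicator_def power2_eq_square algebra_simps)
  also have "\<dots> = pmf p i * (1 - pmf p i)"
    using bd by (simp add: measure_pmf_single power2_eq_square algebra_simps)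
  finally have "L2_normalized_centered (pmf p) ?g"
    using bd a2 by (intro L2_normalized_centered_bounded) (auto simp: power_mult_distrib measure_pmf_single)
  moreover have "x - pmf p i - (y - pmf p i) = x - y" for x y by simp
  then have "dirichlet q (pmf p) (\<lambda>k. ?d k - pmf p i) = dirichlet q (pmf p) ?d"
    by (simp only: dirichlet_def)
  then have "dirichlet q (pmf p) ?g < top"
    unfolding dirichlet_scale using fin by (simp add: ennreal_mult_less_top)
  ultimately show ?thesis by blast
qed

lemma exp_rate_le_gap:
  assumes "i \<noteq> (j :: 'a)" and f: "\<And>i. 1 \<le> f i" and "exp_rate P (pmf p) f \<epsilon>"
  shows "\<epsilon> \<le> gap"
proof -
  obtain C where C: "0 < \<epsilon>" "\<And>i. 0 < C i"
    "\<And>i t. 0 \<le> t \<Longrightarrow> fnorm f (\<lambda>j. P t i j - pmf p j) \<le> ennreal (C i * exp (- \<epsilon> * t))"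
    using assms(3) by (auto simp: exp_rate_def)
  let ?I = "INF g \<in> {g. L2_normalized_centered (pmf p) g}. dirichlet q (pmf p) g"
  obtain g where "L2_normalized_centered (pmf p) g" "dirichlet q (pmf p) g < top"
    using dirichlet_test_function[OF assms(1)] by blast
  then have "?I < top" by (intro INF_less_iff[THEN iffD2]) auto
  moreover have "ennreal \<epsilon> \<le> ?I"
    using rate_le_dirichlet[OF C(3) f less_imp_le[OF C(2)]] by (intro INF_greatest) auto
  ultimately show ?thesis unfolding spectral_gap_def using C(1)
    by (metis ennreal_enn2real ennreal_le_iff2 enn2real_nonneg less_le_not_le)
qed

lemma exp_rate_gap:
  assumes f: "\<And>i. 1 \<le> f i" and f2: "esum (\<lambda>k. pmf p k * (f k)\<^sup>2) < \<infinity>" and gap: "0 < gap"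
  shows "exp_rate P (pmf p) f gap"
proof -
  let ?C = "\<lambda>i. sqrt (enn2real (esum (\<lambda>k. pmf p k * (f k)\<^sup>2))) * sqrt (1 / pmf p i - 1)"
  have "0 \<le> ?C i" for i using pmf_le_1[of p i] pmf_pos[of i] by simp
  \<comment> \<open>A rate requires strictly positive constants, which the added 1 provides.\<close>
  then have C: "0 < ?C i + 1" for i by (rule add_nonneg_pos) simp
  have "fnorm f (\<lambda>j. P t i j - pmf p j) \<le> ennreal ((?C i + 1) * exp (- gap * t))" if t: "0 \<le> t" for i t
  proof -
    have "0 \<le> f i" for i using f[of i] by simp
    then have "fnorm f (\<lambda>j. P t i j - pmf p j) \<le> ennreal (?C i * exp (- gap * t))"
      using fnorm_bound[OF _ f2 t, of i] by simp
    also have "\<dots> \<le> ennreal ((?C i + 1) * exp (- gap * t))"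
      by (intro ennreal_leI mult_right_mono) auto
    finally show ?thesis .
  qed
  then show ?thesis using C gap unfolding exp_rate_def by (intro conjI exI[of _ "\<lambda>i. ?C i + 1"]) auto
qed

end

section \<open>The equivalence, the maximal rate and the explicit bound\<close>

theorem theorem1p1:
  fixes q :: "'a::countable \<Rightarrow> 'a \<Rightarrow> real"
    and P :: "real \<Rightarrow> 'a \<Rightarrow> 'a \<Rightarrow> real"
    and \<pi> :: "'a \<Rightarrow> real"
    and f :: "'a \<Rightarrow> real"
  assumes nontriv: "\<exists>i j::'a. i \<noteq> j"
    and chain: "markov_chain_of q P"
    and posrec: "positive_recurrent P \<pi>"
    and pos: "\<forall>i. 0 < \<pi> i"
    and rev: "reversible P \<pi>"
    and f_ge: "\<forall>i. 1 \<le> f i"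
    and f2: "esum (\<lambda>i. \<pi> i * (f i)\<^sup>2) < \<infinity>"
  shows "(exp_f_ergodic P \<pi> f \<longleftrightarrow> spectral_gap q \<pi> > 0)
    \<and> eps_max P \<pi> f = ereal (spectral_gap q \<pi>)
    \<and> (\<forall>i. \<forall>t\<ge>0. fnorm f (\<lambda>j. P t i j - \<pi> j)
          \<le> ennreal (sqrt (enn2real (esum (\<lambda>k. \<pi> k * (f k)\<^sup>2))) * sqrt (1 / \<pi> i - 1)
                     * exp (- spectral_gap q \<pi> * t)))"
proof -
  define p where "p = embed_pmf \<pi>"
  have p: "pmf p = \<pi>"
    using posrec unfolding p_def positive_recurrent_def stationary_dist_def esum_def
    by (intro ext pmf_embed_pmf) auto
  interpret q_transition q P
    using chain by unfold_locales (simp add: markov_chain_of_def)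
  \<comment> \<open>Uniqueness, applied to the process \<open>minimal P\<close>, yields
    \<open>minimal_eq\<close>.\<close>
  interpret reversible_chain q P p
    using chain rev pos minimal_q_process
    by unfold_locales (auto simp: markov_chain_of_def reversible_def p)
  obtain a b :: 'a where ab: "a \<noteq> b" using nontriv by blast
  have f1: "1 \<le> f i" and f0: "0 \<le> f i" for i using f_ge order_trans[of 0 1 "f i"] by auto
  have upper: "\<epsilon> \<le> gap" if "exp_rate P \<pi> f \<epsilon>" for \<epsilon>
    using exp_rate_le_gap[OF ab f1] that by (simp add: p)
  have lower: "exp_rate P \<pi> f gap" if "0 < gap"
    using exp_rate_gap[OF f1 _ that] f2 by (simp add: p)
  have "exp_f_ergodic P \<pi> f \<longleftrightarrow> 0 < gap"
  proof
    assume "exp_f_ergodic P \<pi> f"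
    then obtain \<epsilon> where "exp_rate P \<pi> f \<epsilon>" by (auto simp: exp_f_ergodic_def)
    with upper[OF this] show "0 < gap" by (auto simp: exp_rate_def)
  qed (use lower in \<open>auto simp: exp_f_ergodic_def\<close>)
  moreover have "eps_max P \<pi> f = ereal gap"
    unfolding eps_max_def
  proof (rule antisym)
    show "Sup ({0} \<union> ereal ` {\<epsilon>. exp_rate P \<pi> f \<epsilon>}) \<le> ereal gap"
      using upper gap_nonneg by (intro Sup_least) auto
    show "ereal gap \<le> Sup ({0} \<union> ereal ` {\<epsilon>. exp_rate P \<pi> f \<epsilon>})"
    proof (rule Sup_upper)
      \<comment> \<open>A positive gap is itself a rate; a gap of 0 is covered by the element 0 put
        into the supremum.\<close>
      show "ereal gap \<in> {0} \<union> ereal ` {\<epsilon>. exp_rate P \<pi> f \<epsilon>}"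
        using lower gap_nonneg by (cases "gap = 0") (auto simp: zero_ereal_def)
    qed
  qed
  moreover have "fnorm f (\<lambda>j. P t i j - \<pi> j)
          \<le> ennreal (sqrt (enn2real (esum (\<lambda>k. \<pi> k * (f k)\<^sup>2))) * sqrt (1 / \<pi> i - 1) * exp (- gap * t))"
    if "0 \<le> t" for i t
    using fnorm_bound[OF f0 _ that, where i = i] f2 by (simp add: p)
  ultimately show ?thesis by (simp add: p)
qed

end
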